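(* Let $k\ge 3$ be an integer and let $d_k$ denote the Tur\'an density of $K_k=K_k^{(k-1)}$. For every fixed real $c$ with $0<c<d_k$ there is a constant $b>0$ such that, for all sufficiently large $n$, $$h_{k-1}(n,c)\le n^{b/\log\log n}.$$
   Context: A $(k-1)$-graph is a $(k-1)$-uniform hypergraph. $K_k=K_k^{(k-1)}$ denotes the complete $(k-1)$-graph on $k$ vertices. For an integer $n$ and a positive real $c$, $h_{k-1}(n,c)$ is the maximum number $h$ such that every $n$-vertex $(k-1)$-graph with at least $c n^{k-1}$ edges, in which every edge is contained in a copy of $K_k$, must contain an edge lying in at least $h$ copies of $K_k$. The Tur\'an density of $K_k$ is $d_k=\lim_{n\to\infty} ex_{k-1}(n,K_k)/n^{k-1}$, where $ex_{k-1}(n,K_k)$ is the maximum number of edges of an $n$-vertex $(k-1)$-graph containing no copy of $K_k$ (this limit exists and is positive; for $k=3$ it equals $1/4$). *)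

theory Defs
  imports Complex_Main "HOL-Library.Ramsey" "HOL-Library.Extended_Real"
begin

text \<open>
  An \<open>r\<close>-uniform hypergraph is a pair of a finite vertex set and a set of \<open>r\<close>-element subsets of it;
  \<open>nsets V r\<close> is the set of \<open>r\<close>-element subsets of \<open>V\<close>. Vertices are natural numbers, which
  represents every finite hypergraph up to isomorphism.
\<close>

definition uniform_hypergraph :: "nat \<Rightarrow> nat set \<Rightarrow> nat set set \<Rightarrow> bool" where
  "uniform_hypergraph r V E \<longleftrightarrow> finite V \<and> E \<subseteq> nsets V r"

text \<open>
  The copies of \<open>K\<^sub>m\<^sup>(\<^sup>r\<^sup>)\<close>, each identified with its vertex set. A copy contains an edge \<open>e\<close>
  exactly when \<open>e\<close> is a subset of its vertex set.
\<close>

definition complete_copies :: "nat \<Rightarrow> nat \<Rightarrow> nat set \<Rightarrow> nat set set \<Rightarrow> nat set set" where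
  "complete_copies r m V E = {K \<in> nsets V m. nsets K r \<subseteq> E}"

definition turan_number :: "nat \<Rightarrow> nat \<Rightarrow> nat \<Rightarrow> nat" where
  "turan_number r n m =
     Max {card E | V E. uniform_hypergraph r V E \<and> card V = n \<and> complete_copies r m V E = {}}"

text \<open>
  The normalisation is by \<open>n ^ (k - 1)\<close>, not by the binomial coefficient \<open>n choose (k - 1)\<close>.
\<close>

definition turan_density :: "nat \<Rightarrow> real" where
  "turan_density k = lim (\<lambda>n. real (turan_number (k - 1) n k) / real n ^ (k - 1))"

definition admissible_hypergraph :: "nat \<Rightarrow> nat \<Rightarrow> real \<Rightarrow> nat set \<Rightarrow> nat set set \<Rightarrow> bool" where
  "admissible_hypergraph r n c V E \<longleftrightarrow>
     uniform_hypergraph r V E \<and> card V = n \<and> real (card E) \<ge> c * real n ^ r \<and>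
     (\<forall>e\<in>E. \<exists>K\<in>complete_copies r (r + 1) V E. e \<subseteq> K)"

text \<open>
  \<open>max_edge_copies r n c\<close> is the function \<open>h\<^sub>r(n, c)\<close>. The supremum is taken in the extended naturals,
  so that the value is \<open>\<infinity>\<close>, and not an arbitrary number, if there is no admissible hypergraph at
  all. If there is one, and \<open>c\<close> and \<open>n\<close> are positive (so that it has an edge), then the set below is
  bounded and contains \<open>0\<close>, and the supremum is its maximum.
\<close>

definition max_edge_copies :: "nat \<Rightarrow> nat \<Rightarrow> real \<Rightarrow> enat" where
  "max_edge_copies r n c =
     Sup (enat ` {h. \<forall>V E. admissible_hypergraph r n c V E \<longrightarrow>
            (\<exists>e\<in>E. h \<le> card {K \<in> complete_copies r (r + 1) V E. e \<subseteq> K})})"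

end

theory Submission
  imports Defs "HOL-Library.FuncSet" "HOL-Real_Asymp.Real_Asymp"
begin

text \<open>
  Let \<open>r = k - 1\<close>. Take a fixed \<open>K\<^sub>k\<close>-free \<open>r\<close>-graph whose edge density exceeds \<open>c\<close>, and
  blow up each of its vertices to several copies of the grid \<open>{-R..R}\<^sup>d\<close>. Call a transversal of
  an edge a base set if its \<open>r\<close> vectors are nearly orthogonal and have nearly the typical norm. By
  concentration of measure almost all transversals are base sets, and these are edges. A small
  further set \<open>C\<close> contains a vertex for every possible vector sum; the vertex \<open>s \<in> C\<close> for the sum of a
  base set \<open>x\<close> completes \<open>x\<close> to a copy of \<open>K\<^sub>k\<close>, so all \<open>r\<close>-subsets of \<open>{s} \<union> x\<close> are made edges.

  The blow-up has no copy of \<open>K\<^sub>k\<close> outside \<open>C\<close>, so every copy is of the form \<open>{s} \<union> x\<close> with \<open>x\<close> a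
  base set. Its edges through \<open>s\<close> determine the inner products of \<open>s\<close> with itself and with the
  members of \<open>x\<close> up to \<open>O(d)\<close>, which forces the distance of \<open>s\<close> from the vector sum of \<open>x\<close> to be
  \<open>O(\<surd>d)\<close>. Hence, given an edge, the remaining vertex of a copy lies in a ball with only
  \<open>exp (O(d))\<close> lattice points, each of them used \<open>exp (O(d))\<close> times, where \<open>d\<close> is of order
  \<open>ln n / ln ln n\<close>.
\<close>

section \<open>Turan densities\<close>

text \<open>Infinitely many pairs \<open>V\<close>, \<open>E\<close> qualify, but only
  \<open>card E\<close> is collected, and it is at most \<open>n choose r\<close>. So the
  \<open>Max\<close> in \<open>turan_number\<close> is over a finite set.\<close>

lemma finite_turan_set:
  "finite {card E | V E. uniform_hypergraph r V E \<and> card V = n \<and> complete_copies r m V E = {}}"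
proof (rule finite_subset)
  show "{card E | V E. uniform_hypergraph r V E \<and> card V = n \<and> complete_copies r m V E = {}}
    \<subseteq> {..n choose r}"
  proof clarsimp
    fix V E assume "uniform_hypergraph r V E"
    then show "card E \<le> card V choose r"
      using card_mono[of "nsets V r" E] by (auto simp: uniform_hypergraph_def finite_imp_finite_nsets)
  qed
qed simp

lemma card_le_turan_number:
  assumes "uniform_hypergraph r V E" and "complete_copies r m V E = {}"
  shows "card E \<le> turan_number r (card V) m"
  unfolding turan_number_def using assms by (intro Max_ge finite_turan_set) blast

text \<open>For \<open>r \<le> m\<close> every \<open>m\<close>-set has an \<open>r\<close>-subset,
  so the edgeless hypergraph contains no copy and the \<open>Max\<close> is over a nonempty
  set.\<close>

lemma turan_number_attained:
  assumes "r \<le> m"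
  obtains V E where "uniform_hypergraph r V E" "card V = n" "complete_copies r m V E = {}"
    "card E = turan_number r n m"
proof -
  let ?S = "{card E | V E. uniform_hypergraph r V E \<and> card V = n \<and> complete_copies r m V E = {}}"
  have "nsets K r \<noteq> {}" if "K \<in> nsets {..<n} m" for K
    unfolding nsets_eq_empty_iff using that assms by (simp add: nsets_def)
  then have "complete_copies r m {..<n} {} = {}"
    by (auto simp: complete_copies_def)
  then have "card ({} :: nat set set) \<in> ?S"
    by (intro CollectI exI[of _ "{}"] exI[of _ "{..<n}"]) (auto simp: uniform_hypergraph_def)
  then have "turan_number r n m \<in> ?S"
    unfolding turan_number_def using finite_turan_set by (intro Max_in) blast+
  then show thesis using that by auto
qed

text \<open>Double counting of pairs of a vertex and an edge avoiding it, in an extremal hypergraph: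
  each edge misses \<open>Suc n - r\<close> vertices, and the edges missing a given vertex form a
  copy-free hypergraph on the \<open>n\<close> remaining ones.\<close>

lemma turan_number_Suc_le:
  assumes "r \<le> m"
  shows "(Suc n - r) * turan_number r (Suc n) m \<le> Suc n * turan_number r n m"
proof -
  obtain V E where V: "uniform_hypergraph r V E" "card V = Suc n" "complete_copies r m V E = {}"
    "card E = turan_number r (Suc n) m"
    using turan_number_attained[OF assms] by blast
  have fin: "finite V" "finite E" and E: "E \<subseteq> nsets V r"
    using V(1) finite_subset[of E "nsets V r"]
    by (auto simp: uniform_hypergraph_def finite_imp_finite_nsets)
  have "(\<Sum>v\<in>V. card {e \<in> E. v \<notin> e}) = (\<Sum>v\<in>V. \<Sum>e\<in>E. if v \<notin> e then 1 else 0)"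
    using fin by (simp add: sum.If_cases Int_def)
  also have "\<dots> = (\<Sum>e\<in>E. \<Sum>v\<in>V. if v \<notin> e then 1 else 0)"
    by (rule sum.swap)
  also have "\<dots> = (\<Sum>e\<in>E. card (V - e))"
    using fin by (intro sum.cong) (auto simp: sum.If_cases Int_def set_diff_eq)
  also have "\<dots> = (\<Sum>e\<in>E. Suc n - r)"
    using E V(2) by (intro sum.cong) (auto simp: nsets_def card_Diff_subset)
  finally have "(Suc n - r) * card E = (\<Sum>v\<in>V. card {e \<in> E. v \<notin> e})"
    by simp
  also have "\<dots> \<le> (\<Sum>v\<in>V. turan_number r n m)"
  proof (rule sum_mono)
    fix v assume "v \<in> V"
    have "uniform_hypergraph r (V - {v}) {e \<in> E. v \<notin> e}"
      using fin E by (auto simp: uniform_hypergraph_def nsets_def)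
    moreover have "complete_copies r m (V - {v}) {e \<in> E. v \<notin> e} = {}"
      using V(3) by (auto simp: complete_copies_def nsets_def)
    ultimately show "card {e \<in> E. v \<notin> e} \<le> turan_number r n m"
      using card_le_turan_number[of r "V - {v}" "{e \<in> E. v \<notin> e}" m] \<open>v \<in> V\<close> V(2) by simp
  qed
  finally show ?thesis using V by simp
qed

text \<open>Serves to pass from the normalisation by \<open>n choose r\<close>, for which averaging
  gives monotonicity, to the one by \<open>n ^ r\<close>.\<close>

lemma choose_over_power_tendsto:
  "(\<lambda>n. real (n choose r) / real n ^ r) \<longlonglongrightarrow> 1 / fact r"
proof -
  have "(\<lambda>n. (\<Prod>i<r. (real n - real i) / real n) / fact r) \<longlonglongrightarrow> (\<Prod>i<r. 1) / fact r"
  proof (intro tendsto_divide tendsto_prod tendsto_const)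
    show "(\<lambda>n. (real n - real i) / real n) \<longlonglongrightarrow> 1" for i by real_asymp
  qed simp
  moreover have "(\<Prod>i<r. (real n - real i) / real n) / fact r = real (n choose r) / real n ^ r" for n
    by (simp add: binomial_gbinomial gbinomial_prod_rev prod_dividef atLeast0LessThan)
  ultimately show ?thesis by simp
qed

text \<open>Averaging over vertex deletions shows that the Turan number divided by \<open>n choose r\<close>
  is decreasing.\<close>

lemma convergent_turan_quotient:
  assumes "r \<le> m"
  shows "convergent (\<lambda>n. real (turan_number r n m) / real n ^ r)"
proof -
  \<comment> \<open>The shift by \<open>r\<close> keeps the binomial coefficient positive for every
    \<open>n\<close>.\<close>
  define q where "q n = real (turan_number r (n + r) m) / real (n + r choose r)" for n
  have "q (Suc n) \<le> q n" for n
  proof -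
    let ?t = "\<lambda>n. real (turan_number r n m)"
    have "real (Suc n) * ?t (Suc (n + r)) \<le> real (Suc (n + r)) * ?t (n + r)"
      using turan_number_Suc_le[OF assms, of "n + r"] Suc_diff_le[of r "n + r"]
      by (metis add_diff_cancel_right' le_add2 of_nat_le_iff of_nat_mult)
    moreover have "real (Suc n) * real (Suc (n + r) choose r) = real (Suc (n + r)) * real (n + r choose r)"
      proof -
      have "Suc n * (Suc (n + r) choose r) = Suc (n + r) * (n + r choose r)"
        using binomial_absorb_comp[of "Suc (n + r)" r] Suc_diff_le[of r "n + r"]
        by (simp only: add_diff_cancel_right' diff_Suc_1 le_add2)
      then show ?thesis by (simp only: flip: of_nat_mult)
    qed
    ultimately have "(real (Suc n) * ?t (Suc (n + r))) / (real (Suc n) * real (Suc (n + r) choose r))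
        \<le> (real (Suc (n + r)) * ?t (n + r)) / (real (Suc (n + r)) * real (n + r choose r))"
      by (metis divide_right_mono mult_nonneg_nonneg of_nat_0_le_iff)
    then show ?thesis
      unfolding q_def add_Suc by (simp only: mult_divide_mult_cancel_left_if of_nat_eq_0_iff nat.simps if_False)
  qed
  then have "decseq q" by (rule decseq_SucI)
  moreover have "q n \<ge> 0" for n by (simp add: q_def)
  ultimately obtain l where "q \<longlonglongrightarrow> l"
    using decseq_convergent by blast
  then have "(\<lambda>n. real (turan_number r n m) / real (n choose r)) \<longlonglongrightarrow> l"
    unfolding q_def by (rule LIMSEQ_offset)
  from tendsto_mult[OF this choose_over_power_tendsto]
  have "(\<lambda>n. real (turan_number r n m) / real (n choose r) * (real (n choose r) / real n ^ r))
    \<longlonglongrightarrow> l * (1 / fact r)" .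
  moreover have "eventually (\<lambda>n. real (turan_number r n m) / real (n choose r) * (real (n choose r) / real n ^ r)
      = real (turan_number r n m) / real n ^ r) sequentially"
    using eventually_ge_at_top[of r] by eventually_elim (simp add: zero_less_binomial_iff)
  ultimately show ?thesis
    unfolding convergent_def using tendsto_cong by fast
qed

text \<open>A limit above \<open>c\<close> has a term above \<open>c\<close>. One such hypergraph is
  fixed once and for all; the strict surplus over \<open>c\<close> pays for all losses in the
  blow-up.\<close>

lemma dense_clique_free_hypergraph:
  assumes "c < turan_density k" and "k \<ge> 1"
  obtains V E where "uniform_hypergraph (k - 1) V E" "card V > 0"
    "complete_copies (k - 1) k V E = {}" "real (card E) > c * real (card V) ^ (k - 1)"
proof -
  have "(\<lambda>n. real (turan_number (k - 1) n k) / real n ^ (k - 1)) \<longlonglongrightarrow> turan_density k"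
    unfolding turan_density_def using convergent_turan_quotient[of "k - 1" k]
    by (simp add: convergent_LIMSEQ_iff)
  then have "eventually (\<lambda>n. c < real (turan_number (k - 1) n k) / real n ^ (k - 1) \<and> n > 0) sequentially"
    using order_tendstoD(1)[OF _ assms(1)] eventually_gt_at_top[of "0::nat"] eventually_conj by blast
  then obtain n where n: "c < real (turan_number (k - 1) n k) / real n ^ (k - 1)" "n > 0"
    using eventually_happens' by (metis (no_types, lifting) sequentially_bot)
  obtain V E where "uniform_hypergraph (k - 1) V E" "card V = n"
    "complete_copies (k - 1) k V E = {}" "card E = turan_number (k - 1) n k"
    using turan_number_attained[of "k - 1" k n] by auto
  with n show thesis by (intro that) (auto simp: field_simps)
qed

section \<open>Concentration and lattice points in product sets\<close>

lemma sum_PiE_insert: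
  assumes "finite I" and "i \<notin> I"
  shows "(\<Sum>x\<in>PiE (insert i I) B. f x) = (\<Sum>v\<in>B i. \<Sum>x\<in>PiE I B. f (x(i := v)))"
proof -
  have "(\<Sum>x\<in>PiE (insert i I) B. f x) = (\<Sum>(v, x)\<in>B i \<times> PiE I B. f (x(i := v)))"
    unfolding PiE_insert_eq
    by (subst sum.reindex[OF inj_combinator[OF assms(2)]]) (simp add: case_prod_beta)
  then show ?thesis by (simp add: sum.cartesian_product)
qed

text \<open>The variance of a sum of independent centred variables, written with sums in place of
  expectations. Adding a coordinate creates a cross term, which vanishes because \<open>g\<close> is
  centred.\<close>

lemma second_moment_PiE:
  fixes g :: "'b \<Rightarrow> real"
  assumes "finite I" and "finite B" and centred: "(\<Sum>v\<in>B. g v) = 0"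
    and bound: "\<And>v. v \<in> B \<Longrightarrow> \<bar>g v\<bar> \<le> K"
  shows "(\<Sum>x\<in>PiE I (\<lambda>_. B). (\<Sum>i\<in>I. a i * g (x i))\<^sup>2)
    \<le> real (card B) ^ card I * K\<^sup>2 * (\<Sum>i\<in>I. (a i)\<^sup>2)"
  using \<open>finite I\<close>
proof induction
  case (insert i I)
  let ?X = "PiE I (\<lambda>_. B)" and ?q = "real (card B)"
  let ?S = "\<lambda>x. \<Sum>j\<in>I. a j * g (x j)"
  have "(\<Sum>x\<in>PiE (insert i I) (\<lambda>_. B). (\<Sum>j\<in>insert i I. a j * g (x j))\<^sup>2)
    = (\<Sum>v\<in>B. \<Sum>x\<in>?X. (a i * g v + ?S x)\<^sup>2)"
    using insert.hyps by (subst sum_PiE_insert) (auto intro!: sum.cong arg_cong[of _ _ "\<lambda>t. t\<^sup>2"])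
  also have "\<dots> = (\<Sum>v\<in>B. \<Sum>x\<in>?X. (a i * g v)\<^sup>2) + (\<Sum>v\<in>B. \<Sum>x\<in>?X. g v * (2 * a i * ?S x))
      + (\<Sum>v\<in>B. \<Sum>x\<in>?X. (?S x)\<^sup>2)"
    by (simp add: power2_sum sum.distrib mult_ac)
  also have "(\<Sum>v\<in>B. \<Sum>x\<in>?X. g v * (2 * a i * ?S x)) = 0"
    by (subst sum_product[symmetric]) (simp add: centred)
  also have "(\<Sum>v\<in>B. \<Sum>x\<in>?X. (a i * g v)\<^sup>2) \<le> (\<Sum>v\<in>B. \<Sum>x\<in>?X. (a i)\<^sup>2 * K\<^sup>2)"
    using bound by (intro sum_mono) (auto simp: power_mult_distrib intro!: mult_left_mono abs_le_square_iff[THEN iffD1] order_trans[OF _ abs_ge_self])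
  also have "\<dots> = ?q * ?q ^ card I * K\<^sup>2 * (a i)\<^sup>2"
    using insert.hyps by (simp add: card_PiE mult_ac)
  also have "(\<Sum>v\<in>B. \<Sum>x\<in>?X. (?S x)\<^sup>2) \<le> ?q * (?q ^ card I * K\<^sup>2 * (\<Sum>i\<in>I. (a i)\<^sup>2))"
    using insert.IH by (simp add: mult_left_mono)
  finally show ?case using insert.hyps by (simp add: algebra_simps)
qed simp

text \<open>Chebyshev's inequality at threshold \<open>d\<close>: the second moment is at most
  \<open>d * (K * A)\<^sup>2\<close> times the number of points, and the division by
  \<open>d\<^sup>2\<close> leaves \<open>(K * A)\<^sup>2 / d\<close>.\<close>

lemma card_large_deviation_PiE:
  fixes g :: "'b \<Rightarrow> real"
  assumes "d > 0" and "finite B" and "(\<Sum>v\<in>B. g v) = 0"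
    and "\<And>v. v \<in> B \<Longrightarrow> \<bar>g v\<bar> \<le> K" and "\<And>i. i < d \<Longrightarrow> \<bar>a i\<bar> \<le> A"
  shows "real (card {x \<in> PiE {..<d} (\<lambda>_. B). \<bar>\<Sum>i<d. a i * g (x i)\<bar> > real d})
    \<le> (K * A)\<^sup>2 / real d * real (card B) ^ d"
proof -
  let ?X = "PiE {..<d} (\<lambda>_. B)" and ?f = "\<lambda>x. (\<Sum>i<d. a i * g (x i))"
  let ?Z = "{x \<in> ?X. \<bar>?f x\<bar> > real d}"
  have fin: "finite ?X" using assms(2) by (intro finite_PiE) auto
  have "real (card ?Z) * (real d)\<^sup>2 = (\<Sum>x\<in>?Z. (real d)\<^sup>2)" by simp
  also have "\<dots> \<le> (\<Sum>x\<in>?Z. (?f x)\<^sup>2)"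
    by (intro sum_mono) (auto simp flip: abs_le_square_iff)
  also have "\<dots> \<le> (\<Sum>x\<in>?X. (?f x)\<^sup>2)"
    using fin by (intro sum_mono2) auto
  also have "\<dots> \<le> real (card B) ^ d * K\<^sup>2 * (\<Sum>i<d. (a i)\<^sup>2)"
    using second_moment_PiE[of "{..<d}" B g K a] assms by simp
  also have "(\<Sum>i<d. (a i)\<^sup>2) \<le> (\<Sum>i<d. A\<^sup>2)"
    by (intro sum_mono abs_le_square_iff[THEN iffD1] order_trans[OF assms(5) abs_ge_self]) simp
  finally have "real (card ?Z) * (real d)\<^sup>2 \<le> real (card B) ^ d * K\<^sup>2 * (real d * A\<^sup>2)"
    by (simp add: mult_left_mono)
  then show ?thesis using assms(1)
    by (simp add: field_simps power2_eq_square)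
qed

text \<open>A two-sided geometric series: the points from \<open>t\<close> upwards contribute at
  most 2, those below \<open>t\<close> at most 1.\<close>

lemma sum_exp_neg_abs_le:
  fixes S :: "int set"
  assumes "finite S"
  shows "(\<Sum>z\<in>S. (1/2::real) ^ nat \<bar>z - t\<bar>) \<le> 3"
proof -
  have geom: "(\<Sum>j<N. (1/2::real) ^ j) \<le> 2" for N
  proof -
    have "(\<Sum>j<N. (1/2::real) ^ j) = 2 - 2 * (1/2) ^ N" by (induction N) auto
    then show ?thesis by simp
  qed
  let ?f = "\<lambda>z::int. (1/2::real) ^ nat \<bar>z - t\<bar>"
  obtain N where N: "S \<subseteq> {t - int N..t + int N}"
  proof -
    obtain K where K: "\<And>z. z \<in> S \<Longrightarrow> \<bar>z - t\<bar> \<le> K"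
      using assms finite_imageI[OF assms, of "\<lambda>z. \<bar>z - t\<bar>"] by (metis Max_ge imageI)
    have "S \<subseteq> {t - int (nat K)..t + int (nat K)}" using K by fastforce
    then show thesis using that by blast
  qed
  have "S \<subseteq> (\<lambda>j. t + int j) ` {..<Suc N} \<union> (\<lambda>j. t - int (Suc j)) ` {..<N}"
  proof
    fix z assume "z \<in> S"
    then have "z \<in> {t - int N..t + int N}" using N by blast
    then show "z \<in> (\<lambda>j. t + int j) ` {..<Suc N} \<union> (\<lambda>j. t - int (Suc j)) ` {..<N}"
      by (cases "z \<ge> t") (auto intro: image_eqI[of _ _ "nat (z - t)"] image_eqI[of _ _ "nat (t - z - 1)"])
  qed
  then have "(\<Sum>z\<in>S. ?f z) \<le> (\<Sum>z\<in>(\<lambda>j. t + int j) ` {..<Suc N} \<union> (\<lambda>j. t - int (Suc j)) ` {..<N}. ?f z)"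
    by (intro sum_mono2) auto
  also have "\<dots> \<le> (\<Sum>z\<in>(\<lambda>j. t + int j) ` {..<Suc N}. ?f z) + (\<Sum>z\<in>(\<lambda>j. t - int (Suc j)) ` {..<N}. ?f z)"
    by (subst sum.union_inter[symmetric]) (auto intro!: sum_nonneg)
  also have "(\<Sum>z\<in>(\<lambda>j. t + int j) ` {..<Suc N}. ?f z) = (\<Sum>j<Suc N. (1/2) ^ j)"
    by (subst sum.reindex) (auto simp: inj_on_def)
  also have "(\<Sum>z\<in>(\<lambda>j. t - int (Suc j)) ` {..<N}. ?f z) = (\<Sum>j<N. (1/2) ^ Suc j)"
    by (subst sum.reindex) (auto simp: inj_on_def nat_add_distrib)
  also have "\<dots> = (\<Sum>j<N. (1/2) ^ j) / 2"
    by (simp add: sum_divide_distrib)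
  finally show ?thesis using geom[of N] geom[of "Suc N"] by linarith
qed

text \<open>Give \<open>z\<close> the weight 2 to the power minus its l1-distance from
  \<open>t\<close>. Integers satisfy \<open>\<bar>m\<bar> \<le> m\<^sup>2\<close>, so every point
  counted has weight at least \<open>(1/2) ^ (D * d)\<close>, while the total weight factorises over
  the coordinates into \<open>d\<close> sums of size at most 3.\<close>

lemma card_lattice_ball_le:
  fixes t :: "nat \<Rightarrow> int"
  assumes "finite B"
  shows "real (card {z \<in> PiE {..<d} (\<lambda>_. B). (\<Sum>i<d. (z i - t i)\<^sup>2) \<le> int (D * d)}) \<le> (3 * 2 ^ D) ^ d"
proof -
  let ?X = "PiE {..<d} (\<lambda>_. B)"
  let ?Z = "{z \<in> ?X. (\<Sum>i<d. (z i - t i)\<^sup>2) \<le> int (D * d)}"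
  let ?w = "\<lambda>z. \<Prod>i<d. (1/2::real) ^ nat \<bar>z i - t i\<bar>"
  have fin: "finite ?X" using assms by (intro finite_PiE) auto
  have "real (card ?Z) * (1/2) ^ (D * d) = (\<Sum>z\<in>?Z. (1/2) ^ (D * d))" by simp
  also have "\<dots> \<le> (\<Sum>z\<in>?Z. ?w z)"
  proof (rule sum_mono)
    fix z assume z: "z \<in> ?Z"
    have "(\<Sum>i<d. \<bar>z i - t i\<bar>) \<le> (\<Sum>i<d. (z i - t i)\<^sup>2)"
    proof (rule sum_mono)
      fix i
      show "\<bar>z i - t i\<bar> \<le> (z i - t i)\<^sup>2"
      proof (cases "z i = t i")
        case False
        then have "\<bar>z i - t i\<bar> * 1 \<le> \<bar>z i - t i\<bar> * \<bar>z i - t i\<bar>" by (intro mult_left_mono) auto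
        then show ?thesis by (simp add: power2_eq_square flip: abs_mult)
      qed simp
    qed
    then have "int (\<Sum>i<d. nat \<bar>z i - t i\<bar>) \<le> int (D * d)" using z by simp
    then have "(\<Sum>i<d. nat \<bar>z i - t i\<bar>) \<le> D * d" by (simp only: of_nat_le_iff)
    then show "(1/2) ^ (D * d) \<le> ?w z"
      by (subst power_sum[symmetric]) (intro power_decreasing, auto)
  qed
  also have "\<dots> \<le> (\<Sum>z\<in>?X. ?w z)"
    using fin by (intro sum_mono2 prod_nonneg zero_le_power) auto
  also have "\<dots> = (\<Prod>i<d. \<Sum>z\<in>B. (1/2) ^ nat \<bar>z - t i\<bar>)"
    using assms by (intro prod_sum_PiE[symmetric]) auto
  also have "\<dots> \<le> (\<Prod>i<d. 3)"
    using assms by (intro prod_mono) (auto intro!: sum_nonneg sum_exp_neg_abs_le)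
  finally have "real (card ?Z) / 2 ^ (D * d) \<le> 3 ^ d"
    by (simp add: power_one_over)
  then have "real (card ?Z) \<le> 3 ^ d * 2 ^ (D * d)"
    by (simp add: divide_le_eq)
  then show ?thesis by (simp only: power_mult_distrib power_mult)
qed

section \<open>The blow-up\<close>

definition ip :: "nat \<Rightarrow> (nat \<Rightarrow> int) \<Rightarrow> (nat \<Rightarrow> int) \<Rightarrow> real" where
  "ip d a b = real_of_int (\<Sum>i<d. a i * b i)"

lemma ip_commute: "ip d a b = ip d b a"
  by (simp add: ip_def mult.commute)

lemma ip_sum_left: "ip d (\<lambda>i. \<Sum>u\<in>x. f u i) b = (\<Sum>u\<in>x. ip d (f u) b)"
  unfolding ip_def by (simp add: sum_distrib_right of_int_sum[symmetric] sum.swap[of _ x] del: of_int_sum)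

lemma ip_sum_right: "ip d b (\<lambda>i. \<Sum>u\<in>x. f u i) = (\<Sum>u\<in>x. ip d b (f u))"
  by (simp add: ip_commute[of d b] ip_sum_left)

lemma ip_cong: "(\<And>i. i < d \<Longrightarrow> a i = a' i) \<Longrightarrow> ip d a b = ip d a' b"
  by (simp add: ip_def)

lemma ip_diff_diff:
  "real_of_int (\<Sum>i<d. (a i - b i)\<^sup>2) = ip d a a - 2 * ip d a b + ip d b b"
  by (simp add: ip_def power2_eq_square algebra_simps sum.distrib sum_subtractf sum_distrib_left)

text \<open>\<open>P\<close> stands for the typical squared norm; later it is \<open>d\<close> times
  the mean square of a coordinate. The tolerance \<open>d\<close> is the threshold of the Chebyshev
  bound.\<close>

definition near_orthogonal ::
  "nat \<Rightarrow> real \<Rightarrow> ('v \<Rightarrow> nat \<Rightarrow> int) \<Rightarrow> 'v set \<Rightarrow> bool" where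
  "near_orthogonal d P vec x \<longleftrightarrow>
     (\<forall>u\<in>x. \<bar>ip d (vec u) (vec u) - P\<bar> \<le> real d) \<and>
     (\<forall>u\<in>x. \<forall>w\<in>x. u \<noteq> w \<longrightarrow> \<bar>ip d (vec u) (vec w)\<bar> \<le> real d)"

text \<open>The term of \<open>u\<close> itself is \<open>P\<close> up to \<open>d\<close>, and
  every other term is 0 up to \<open>d\<close>.\<close>

lemma near_orthogonal_ip_sum:
  assumes "near_orthogonal d P vec x" and "finite x" and "u \<in> x"
  shows "\<bar>ip d (\<lambda>i. \<Sum>w\<in>x. vec w i) (vec u) - P\<bar> \<le> real (card x) * real d"
proof -
  have "ip d (\<lambda>i. \<Sum>w\<in>x. vec w i) (vec u) - P = (\<Sum>w\<in>x. ip d (vec w) (vec u) - (if w = u then P else 0))"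
    using assms by (simp add: ip_sum_left sum_subtractf)
  also have "\<bar>\<dots>\<bar> \<le> (\<Sum>w\<in>x. real d)"
    using assms by (intro order_trans[OF sum_abs] sum_mono) (auto simp: near_orthogonal_def)
  finally show ?thesis by simp
qed

lemma near_orthogonal_norm_sum:
  assumes "near_orthogonal d P vec x" and "finite x"
  shows "\<bar>ip d (\<lambda>i. \<Sum>w\<in>x. vec w i) (\<lambda>i. \<Sum>w\<in>x. vec w i) - real (card x) * P\<bar>
    \<le> (real (card x))\<^sup>2 * real d"
proof -
  let ?s = "\<lambda>i. \<Sum>w\<in>x. vec w i"
  have "ip d ?s ?s - real (card x) * P = (\<Sum>u\<in>x. ip d ?s (vec u) - P)"
    unfolding ip_sum_right[of d ?s] by (simp add: sum_subtractf)
  also have "\<bar>\<dots>\<bar> \<le> (\<Sum>u\<in>x. real (card x) * real d)"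
    using near_orthogonal_ip_sum[OF assms] by (intro order_trans[OF sum_abs] sum_mono) auto
  finally show ?thesis by (simp add: power2_eq_square)
qed

lemma card_vimage_le:
  assumes "finite Z" and "\<And>z. card {u \<in> S. f u = z} \<le> F"
  shows "card {u \<in> S. f u \<in> Z} \<le> F * card Z"
proof -
  have "{u \<in> S. f u \<in> Z} = (\<Union>z\<in>Z. {u \<in> S. f u = z})" by auto
  then have "card {u \<in> S. f u \<in> Z} \<le> (\<Sum>z\<in>Z. card {u \<in> S. f u = z})"
    using card_UN_le[OF assms(1), of "\<lambda>z. {u \<in> S. f u = z}"] by simp
  also have "\<dots> \<le> F * card Z"
    using sum_bounded_above[of Z "\<lambda>z. card {u \<in> S. f u = z}" F] assms(2) by (simp add: mult.commute)
  finally show ?thesis .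
qed

lemma ex_nset_between:
  assumes "finite K" and "S \<subseteq> K" and "card S \<le> r" and "r \<le> card K"
  shows "\<exists>e\<in>nsets K r. S \<subseteq> e"
proof -
  obtain e where "S \<subseteq> e" "e \<subseteq> K" "card e = r"
    using exists_subset_between[OF assms(3,4,2,1)] by blast
  then show ?thesis using finite_subset[OF _ assms(1)] by (auto simp: nsets_def)
qed

text \<open>\<open>A\<close> is meant as the blow-up of \<open>V\<^sub>0\<close> with projection
  \<open>part\<close>, and \<open>C\<close> as the reserve of vertices that represent vector sums.
  \<open>V\<close> may exceed \<open>A \<union> C\<close>; the surplus vertices are isolated and
  serve to reach a prescribed order.\<close>

locale vector_blow_up =
  fixes r d :: nat and V\<^sub>0 :: "nat set" and E\<^sub>0 :: "nat set set"
    and V A C :: "nat set" and part :: "nat \<Rightarrow> nat" and vec :: "nat \<Rightarrow> nat \<Rightarrow> int"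
    and P :: real
  assumes r: "r \<ge> 2"
    and hyper0: "uniform_hypergraph r V\<^sub>0 E\<^sub>0"
    and clique_free: "complete_copies r (r + 1) V\<^sub>0 E\<^sub>0 = {}"
    and finite_V: "finite V" and AC_subset: "A \<union> C \<subseteq> V" and AC_disjoint: "A \<inter> C = {}"
begin

definition base :: "nat set set" where
  "base = {x. x \<subseteq> A \<and> inj_on part x \<and> part ` x \<in> E\<^sub>0 \<and> near_orthogonal d P vec x}"

text \<open>Only coordinates below \<open>d\<close> are compared: the vectors used later are
  extensional on \<open>{..<d}\<close>, and sums of such functions need not be.\<close>

definition apex :: "nat set \<Rightarrow> nat \<Rightarrow> bool" where
  "apex x s \<longleftrightarrow> s \<in> C \<and> (\<forall>i<d. vec s i = (\<Sum>u\<in>x. vec u i))"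

definition edges :: "nat set set" where
  "edges = {e. \<exists>x\<in>base. \<exists>s. apex x s \<and> e \<in> nsets (insert s x) r}"

section \<open>Edges and copies in the blow-up\<close>

lemma baseD:
  assumes "x \<in> base"
  shows "x \<subseteq> A" "inj_on part x" "part ` x \<in> E\<^sub>0" "near_orthogonal d P vec x" "finite x" "card x = r"
proof -
  show *: "x \<subseteq> A" "inj_on part x" "part ` x \<in> E\<^sub>0" "near_orthogonal d P vec x"
    using assms by (auto simp: base_def)
  show "finite x" using *(1) AC_subset finite_V by (meson finite_subset le_sup_iff)
  show "card x = r"
    using * hyper0 card_image[of part x] by (auto simp: uniform_hypergraph_def nsets_def)
qed

lemma edges_subset: "edges \<subseteq> nsets V r"
proof
  fix e assume "e \<in> edges"
  then obtain x s where x: "x \<in> base" "apex x s" "e \<in> nsets (insert s x) r"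
    by (auto simp: edges_def)
  then have "insert s x \<subseteq> V" using baseD(1)[OF x(1)] AC_subset by (auto simp: apex_def)
  then show "e \<in> nsets V r" using x(3) nsets_mono by blast
qed

lemma apex_notin_base: "x \<in> base \<Longrightarrow> apex x s \<Longrightarrow> s \<notin> x"
  using baseD(1) AC_disjoint by (auto simp: apex_def)

lemma insert_apex_copy:
  assumes "x \<in> base" and "apex x s"
  shows "insert s x \<in> complete_copies r (r + 1) V edges"
  using assms baseD[OF assms(1)] AC_subset apex_notin_base[OF assms]
  by (auto simp: complete_copies_def nsets_def apex_def edges_def)

lemma edge_in_copy:
  assumes "e \<in> edges"
  shows "\<exists>K\<in>complete_copies r (r + 1) V edges. e \<subseteq> K"
  using assms insert_apex_copy by (auto simp: edges_def nsets_def)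

lemma base_subset_edges:
  assumes "\<And>x. x \<in> base \<Longrightarrow> \<exists>s. apex x s"
  shows "base \<subseteq> edges"
proof
  fix x assume x: "x \<in> base"
  then obtain s where "apex x s" using assms by blast
  then show "x \<in> edges" using x baseD[OF x] by (auto simp: edges_def nsets_def)
qed

lemma edge_card: "e \<in> edges \<Longrightarrow> finite e \<and> card e = r"
  by (auto simp: edges_def nsets_def)

lemma edge_subset_AC: "e \<in> edges \<Longrightarrow> e \<subseteq> A \<union> C"
  using baseD(1) unfolding edges_def nsets_def apex_def by blast

text \<open>An edge that avoids the apex is an \<open>r\<close>-subset of the \<open>r\<close>-set
  \<open>x\<close> it comes from, hence equal to it.\<close>

lemma edge_within_A:
  assumes "e \<in> edges" and "e \<subseteq> A"
  shows "e \<in> base"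
proof -
  obtain x s where x: "x \<in> base" "apex x s" "e \<subseteq> insert s x" "card e = r"
    using assms(1) by (auto simp: edges_def nsets_def)
  have "e \<subseteq> x" using x assms(2) AC_disjoint by (auto simp: apex_def)
  then have "e = x" using x baseD[OF x(1)] card_subset_eq by metis
  then show ?thesis using x by simp
qed

text \<open>Base sets lie in \<open>A\<close>, so a vertex of \<open>C\<close> on an edge can only
  be the apex that generated the edge.\<close>

lemma edge_meeting_C:
  assumes "e \<in> edges" and "s \<in> e" and "s \<in> C"
  obtains x where "x \<in> base" "apex x s" "e \<subseteq> insert s x"
proof -
  obtain x s' where x: "x \<in> base" "apex x s'" "e \<subseteq> insert s' x"
    using assms(1) by (auto simp: edges_def nsets_def)
  have "s' = s" using x assms AC_disjoint baseD(1)[OF x(1)] by auto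
  then show thesis using that x by blast
qed

text \<open>If \<open>K\<close> missed \<open>C\<close>, all its \<open>r\<close>-subsets would be
  base sets; any two vertices lie in one of them, so \<open>part\<close> would be injective on
  \<open>K\<close> and map it to a forbidden copy in \<open>E\<^sub>0\<close>. So \<open>K\<close>
  has a vertex \<open>s\<close> in \<open>C\<close>. Edges through \<open>s\<close> have their other
  vertices in \<open>A\<close>, so \<open>K - {s}\<close> is an edge inside \<open>A\<close>, that
  is, a base set.\<close>

lemma copy_cases:
  assumes K: "K \<in> complete_copies r (r + 1) V edges"
  obtains s x where "K = insert s x" "s \<in> C" "x \<in> base"
proof -
  have fin: "finite K" "card K = r + 1" and sub: "nsets K r \<subseteq> edges"
    using K by (auto simp: complete_copies_def nsets_def)
  \<comment> \<open>Since \<open>r \<ge> 2\<close>, any two vertices of \<open>K\<close> fit into an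
    \<open>r\<close>-subset.\<close>
  have pair: "\<exists>e\<in>edges. e \<subseteq> K \<and> u \<in> e \<and> w \<in> e" if uw: "u \<in> K" "w \<in> K" for u w
  proof -
    have "card {u, w} \<le> r" using r card_insert_le_m1[of 2 "{w}" u] by auto
    then obtain e where "e \<in> nsets K r" "{u, w} \<subseteq> e"
      using ex_nset_between[OF fin(1), of "{u, w}" r] uw fin(2) by auto
    then show ?thesis using sub by (auto simp: nsets_def)
  qed
  have KAC: "K \<subseteq> A \<union> C" using pair edge_subset_AC by blast
  have "K \<inter> C \<noteq> {}"
  proof
    assume "K \<inter> C = {}"
    then have KA: "K \<subseteq> A" using KAC by blast
    then have base: "e \<in> base" if "e \<in> edges" "e \<subseteq> K" for e
      using that edge_within_A by blast
    have inj: "inj_on part K"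
    proof (rule inj_onI)
      fix u w assume uw: "u \<in> K" "w \<in> K" "part u = part w"
      obtain e where "e \<in> edges" "e \<subseteq> K" "u \<in> e" "w \<in> e" using pair[OF uw(1,2)] by blast
      then show "u = w" using baseD(2)[OF base] uw(3) by (auto dest: inj_onD)
    qed
    have "nsets (part ` K) r \<subseteq> E\<^sub>0"
    proof
      fix f assume f: "f \<in> nsets (part ` K) r"
      then obtain e where e: "e \<subseteq> K" "f = part ` e"
        by (auto simp: nsets_def subset_image_iff)
      then have "card e = r" "finite e"
        using f inj fin(1) card_image[OF inj_on_subset[OF inj e(1)]]
        by (auto simp: nsets_def intro: finite_subset)
      then have "e \<in> edges" using sub e(1) by (auto simp: nsets_def)
      then show "f \<in> E\<^sub>0" using baseD(3)[OF base] e by blast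
    qed
    moreover have "part ` K \<subseteq> V\<^sub>0"
    proof
      fix v assume "v \<in> part ` K"
      then obtain u e where "u \<in> e" "v = part u" "e \<in> edges" "e \<subseteq> K" using pair by blast
      then show "v \<in> V\<^sub>0" using baseD(3)[OF base] hyper0
        by (fastforce simp: uniform_hypergraph_def nsets_def)
    qed
    ultimately have "part ` K \<in> complete_copies r (r + 1) V\<^sub>0 E\<^sub>0"
      using fin card_image[OF inj] by (simp add: complete_copies_def nsets_def)
    then show False using clique_free by blast
  qed
  then obtain s where s: "s \<in> K" "s \<in> C" by blast
  have "K - {s} \<subseteq> A"
  proof
    fix u assume u: "u \<in> K - {s}"
    obtain e where "e \<in> edges" "s \<in> e" "u \<in> e" using pair[of s u] s u by blast
    then obtain x where "x \<in> base" "e \<subseteq> insert s x" using edge_meeting_C[OF _ _ s(2)] by metis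
    then show "u \<in> A" using baseD(1)[of x] \<open>u \<in> e\<close> u by blast
  qed
  moreover have "K - {s} \<in> nsets K r" using fin s by (auto simp: nsets_def)
  ultimately have "K - {s} \<in> base" using edge_within_A sub by blast
  then show thesis using that[of s "K - {s}"] s by (simp add: insert_absorb)
qed

text \<open>The vector \<open>s\<close> is itself a sum over a base set through each vertex of \<open>x\<close>, which gives the
  inner products of \<open>s\<close> with itself and with the members of \<open>x\<close> up to an error \<open>O(d)\<close>.\<close>

lemma copy_distance:
  assumes K: "insert s x \<in> complete_copies r (r + 1) V edges" and s: "s \<in> C" and x: "x \<in> base"
  shows "(\<Sum>i<d. (vec s i - (\<Sum>u\<in>x. vec u i))\<^sup>2) \<le> int (4 * r\<^sup>2 * d)"
proof -
  let ?S = "\<lambda>x i. \<Sum>u\<in>x. vec u i"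
  have fx: "finite x" "card x = r" "x \<subseteq> A" using baseD[OF x] by auto
  have sx: "s \<notin> x" using fx s AC_disjoint by auto
  have sub: "nsets (insert s x) r \<subseteq> edges" using K by (auto simp: complete_copies_def)
  \<comment> \<open>An \<open>r\<close>-subset of the copy through \<open>s\<close> and
    \<open>j\<close> is an edge, but it may come from a base set \<open>y\<close> other than
    \<open>x\<close>. This \<open>y\<close> contains \<open>j\<close>, and its vectors sum to
    \<open>vec s\<close>.\<close>
  have through: "\<exists>y\<in>base. apex y s \<and> j \<in> y" if j: "j \<in> x" for j
  proof -
    have "card {s, j} \<le> r" using r card_insert_le_m1[of 2 "{j}" s] by auto
    moreover have "r \<le> card (insert s x)" using fx sx by simp
    ultimately obtain e where e: "e \<in> nsets (insert s x) r" "{s, j} \<subseteq> e"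
      using ex_nset_between[of "insert s x" "{s, j}" r] j fx(1) by blast
    then obtain y where "y \<in> base" "apex y s" "e \<subseteq> insert s y"
      using edge_meeting_C[of e s] sub s by blast
    then show ?thesis using e(2) sx j by auto
  qed
  have apex_ip: "ip d (vec s) b = ip d (?S y) b" if "apex y s" for y b
    using that by (intro ip_cong) (auto simp: apex_def)
  have ipj: "ip d (vec s) (vec j) \<ge> P - real r * real d" if "j \<in> x" for j
  proof -
    obtain y where y: "y \<in> base" "apex y s" "j \<in> y" using through \<open>j \<in> x\<close> by blast
    then show ?thesis
      using near_orthogonal_ip_sum[OF baseD(4,5)[OF y(1)] y(3)] baseD(6)[OF y(1)] apex_ip[OF y(2)]
      by auto
  qed
  have "real r * (P - real r * real d) = (\<Sum>j\<in>x. P - real r * real d)"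
    using fx by simp
  also have "\<dots> \<le> (\<Sum>j\<in>x. ip d (vec s) (vec j))" by (intro sum_mono ipj)
  also have "\<dots> = ip d (vec s) (?S x)" by (simp add: ip_sum_right)
  finally have cross: "ip d (vec s) (?S x) \<ge> real r * (P - real r * real d)" .
  obtain j where "j \<in> x" using fx r by fastforce
  then obtain y where y: "y \<in> base" "apex y s" using through by blast
  have "ip d (vec s) (vec s) = ip d (?S y) (?S y)"
    using apex_ip[OF y(2)] by (metis ip_commute)
  then have norm_s: "ip d (vec s) (vec s) \<le> real r * P + (real r)\<^sup>2 * real d"
    using near_orthogonal_norm_sum[OF baseD(4,5)[OF y(1)]] baseD(6)[OF y(1)] by auto
  have "ip d (?S x) (?S x) \<le> real r * P + (real r)\<^sup>2 * real d"
    using near_orthogonal_norm_sum[OF baseD(4,5)[OF x]] baseD(6)[OF x] by auto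
  \<comment> \<open>The main terms \<open>r * P + r * P - 2 * r * P\<close> cancel; each of the two
    squared norms leaves an error \<open>r\<^sup>2 * d\<close> and the cross term leaves twice that,
    which gives the factor 4.\<close>
  with cross norm_s
  have "real_of_int (\<Sum>i<d. (vec s i - ?S x i)\<^sup>2) \<le> 4 * (real r)\<^sup>2 * real d"
    unfolding ip_diff_diff[where a = "vec s" and b = "?S x"] by (simp add: algebra_simps power2_eq_square)
  also have "\<dots> = real_of_int (int (4 * r\<^sup>2 * d))" by simp
  finally show ?thesis by (simp only: of_int_le_iff)
qed

text \<open>A copy through \<open>e\<close> is determined by its one further vertex. If
  \<open>e\<close> avoids \<open>C\<close>, then \<open>e\<close> is a base set and that vertex is
  in \<open>C\<close>; otherwise it is in \<open>A\<close>. In both cases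
  \<open>copy_distance\<close> confines its vector to a ball depending only on \<open>e\<close>, and
  each vector belongs to at most \<open>F\<close> candidates.\<close>

lemma card_copies_le:
  assumes "e \<in> edges" and finB: "finite B"
    and vecB: "\<And>u. u \<in> A \<union> C \<Longrightarrow> vec u \<in> PiE {..<d} (\<lambda>_. B)"
    and fibre: "\<And>z. card {u \<in> A. vec u = z} \<le> F" "\<And>z. card {u \<in> C. vec u = z} \<le> F"
  shows "real (card {K \<in> complete_copies r (r + 1) V edges. e \<subseteq> K}) \<le> real F * (3 * 2 ^ (4 * r\<^sup>2)) ^ d"
proof -
  define ball where "ball t = {z \<in> PiE {..<d} (\<lambda>_. B). (\<Sum>i<d. (z i - t i)\<^sup>2) \<le> int (4 * r\<^sup>2 * d)}" for t
  let ?K = "{K \<in> complete_copies r (r + 1) V edges. e \<subseteq> K}"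
  have card_ball: "real (card {w \<in> S. vec w \<in> ball t}) \<le> real F * (3 * 2 ^ (4 * r\<^sup>2)) ^ d"
    if "\<And>z. card {u \<in> S. vec u = z} \<le> F" for S t
  proof -
    have "finite (ball t)" unfolding ball_def using finB by (auto intro!: finite_PiE)
    then have "real (card {w \<in> S. vec w \<in> ball t}) \<le> real (F * card (ball t))"
      using card_vimage_le[OF _ that, of "ball t"] by (simp only: of_nat_le_iff)
    also have "\<dots> = real F * real (card (ball t))" by simp
    also have "\<dots> \<le> real F * (3 * 2 ^ (4 * r\<^sup>2)) ^ d"
      unfolding ball_def by (intro mult_left_mono card_lattice_ball_le[OF finB]) auto
    finally show ?thesis .
  qed
  have e: "finite e" "card e = r" using edge_card[OF assms(1)] by auto
  have "\<exists>S t. (S = A \<or> S = C) \<and> ?K \<subseteq> (\<lambda>w. insert w e) ` {w \<in> S. vec w \<in> ball t}"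
  proof (cases "e \<inter> C = {}")
    case True
    have "?K \<subseteq> (\<lambda>w. insert w e) ` {w \<in> C. vec w \<in> ball (\<lambda>i. \<Sum>u\<in>e. vec u i)}"
    proof
      fix K assume K: "K \<in> ?K"
      then obtain s x where sx: "K = insert s x" "s \<in> C" "x \<in> base" using copy_cases by blast
      have "e \<subseteq> x" using K sx True by auto
      then have "e = x" using baseD[OF sx(3)] e card_subset_eq by metis
      then show "K \<in> (\<lambda>w. insert w e) ` {w \<in> C. vec w \<in> ball (\<lambda>i. \<Sum>u\<in>e. vec u i)}"
        using copy_distance[of s x] sx K vecB by (auto simp: ball_def)
    qed
    then show ?thesis by blast
  next
    case False
    then obtain s where s: "s \<in> e" "s \<in> C" by blast
    have "?K \<subseteq> (\<lambda>w. insert w e) ` {w \<in> A. vec w \<in> ball (\<lambda>i. vec s i - (\<Sum>u\<in>e-{s}. vec u i))}"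
    proof
      fix K assume K: "K \<in> ?K"
      then obtain s' x where sx: "K = insert s' x" "s' \<in> C" "x \<in> base" using copy_cases by blast
      have xA: "x \<subseteq> A" "finite x" "card x = r" using baseD[OF sx(3)] by auto
      have "s' = s" using s K sx xA AC_disjoint by auto
      have "e - {s} \<subseteq> x" using K sx \<open>s' = s\<close> by auto
      moreover have "card (x - (e - {s})) = 1"
        using e s xA r calculation by (subst card_Diff_subset) auto
      then obtain w where w: "x - (e - {s}) = {w}" by (auto simp: card_1_singleton_iff)
      ultimately have xw: "x = insert w (e - {s})" "w \<notin> e - {s}" by auto
      have "w \<in> A" using xw xA by auto
      \<comment> \<open>Isolating \<open>vec w\<close> turns the distance of \<open>s\<close> from
        the sum over \<open>x\<close> into a distance of \<open>w\<close> from a centre determined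
        by \<open>e\<close>.\<close>
      have "(vec w i - (vec s i - (\<Sum>u\<in>e-{s}. vec u i)))\<^sup>2 = (vec s i - (\<Sum>u\<in>x. vec u i))\<^sup>2" for i
        using xw e by (simp add: power2_commute algebra_simps)
      then have "vec w \<in> ball (\<lambda>i. vec s i - (\<Sum>u\<in>e-{s}. vec u i))"
        using copy_distance[of s x] sx K vecB \<open>w \<in> A\<close> \<open>s' = s\<close> by (simp add: ball_def)
      moreover have "K = insert w e" using sx xw s \<open>s' = s\<close> by auto
      ultimately show "K \<in> (\<lambda>w. insert w e) ` {w \<in> A. vec w \<in> ball (\<lambda>i. vec s i - (\<Sum>u\<in>e-{s}. vec u i))}"
        using \<open>w \<in> A\<close> by blast
    qed
    then show ?thesis by blast
  qed
  then obtain S t where S: "S = A \<or> S = C" "?K \<subseteq> (\<lambda>w. insert w e) ` {w \<in> S. vec w \<in> ball t}"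
    by blast
  have "finite S" using S(1) finite_V AC_subset finite_subset by (metis le_sup_iff)
  then have "card ?K \<le> card {w \<in> S. vec w \<in> ball t}"
    using S(2) by (intro surj_card_le) auto
  then have "real (card ?K) \<le> real (card {w \<in> S. vec w \<in> ball t})" by simp
  also have "\<dots> \<le> real F * (3 * 2 ^ (4 * r\<^sup>2)) ^ d" using S(1) fibre by (intro card_ball) auto
  finally show ?thesis .
qed

text \<open>Near-orthogonal transversals are built one vertex at a time: each of the at most \<open>r\<close>
  constraints excludes a proportion of at most \<open>\<delta>\<close> of the next part.\<close>

lemma card_near_orthogonal_transversals:
  assumes "T \<ge> 0" and "0 \<le> \<delta>" and "real r * \<delta> \<le> 1"
    and size: "\<And>v. v \<in> V\<^sub>0 \<Longrightarrow> T \<le> real (card {u \<in> A. part u = v})"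
    and norm: "\<And>v. v \<in> V\<^sub>0 \<Longrightarrow> real (card {u \<in> A. part u = v \<and> \<bar>ip d (vec u) (vec u) - P\<bar> > real d}) \<le> \<delta> * T"
    and orth: "\<And>v w. v \<in> V\<^sub>0 \<Longrightarrow> w \<in> A \<Longrightarrow> real (card {u \<in> A. part u = v \<and> \<bar>ip d (vec u) (vec w)\<bar> > real d}) \<le> \<delta> * T"
    and "finite f" and "f \<subseteq> V\<^sub>0" and "card f \<le> r"
  shows "(T * (1 - real r * \<delta>)) ^ card f
    \<le> real (card {x. x \<subseteq> A \<and> bij_betw part x f \<and> near_orthogonal d P vec x})"
  using assms(7-)
proof (induction f)
  case empty
  have "{x. x \<subseteq> A \<and> bij_betw part x {} \<and> near_orthogonal d P vec x} = {{}}"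
    by (auto simp: bij_betw_def near_orthogonal_def)
  then show ?case by simp
next
  case (insert v f)
  let ?G = "\<lambda>f. {x. x \<subseteq> A \<and> bij_betw part x f \<and> near_orthogonal d P vec x}"
  let ?W = "{u \<in> A. part u = v}"
  let ?bad = "\<lambda>w. {u \<in> A. part u = v \<and> \<bar>ip d (vec u) (vec w)\<bar> > real d}"
  let ?badn = "{u \<in> A. part u = v \<and> \<bar>ip d (vec u) (vec u) - P\<bar> > real d}"
  let ?ext = "\<lambda>x. ?W - (?badn \<union> (\<Union>w\<in>x. ?bad w))"
  have finA: "finite A" using finite_V AC_subset finite_subset by (metis le_sup_iff)
  have finG: "finite (?G f)" for f using finA by (auto intro: finite_subset[of _ "Pow A"])
  have v: "v \<in> V\<^sub>0" using insert.prems by simp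
  have ext: "T * (1 - real r * \<delta>) \<le> real (card (?ext x))" if "x \<in> ?G f" for x
  proof -
    have x: "x \<subseteq> A" "finite x" "card x = card f"
      using that finA finite_subset bij_betw_same_card by auto
    have "card (?badn \<union> (\<Union>w\<in>x. ?bad w)) \<le> card ?badn + (\<Sum>w\<in>x. card (?bad w))"
      using card_Un_le[of ?badn "\<Union>w\<in>x. ?bad w"] card_UN_le[OF x(2), of ?bad] by linarith
    then have "real (card (?badn \<union> (\<Union>w\<in>x. ?bad w))) \<le> real (card ?badn) + (\<Sum>w\<in>x. real (card (?bad w)))"
      by (simp flip: of_nat_sum of_nat_add)
    also have "\<dots> \<le> \<delta> * T + (\<Sum>w\<in>x. \<delta> * T)"
      using x(1) v by (intro add_mono sum_mono norm orth) auto
    also have "\<dots> = real (Suc (card f)) * (\<delta> * T)" using x by (simp add: algebra_simps)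
    \<comment> \<open>One norm condition and one condition for each vertex already chosen make
      \<open>Suc (card f)\<close> exclusions, at most \<open>r\<close> because \<open>v\<close> is
      not in \<open>f\<close>.\<close>
    also have "\<dots> \<le> real r * (\<delta> * T)"
      using insert.prems insert.hyps assms(1,2) by (intro mult_right_mono) auto
    finally have "real (card (?badn \<union> (\<Union>w\<in>x. ?bad w))) \<le> real r * (\<delta> * T)" .
    moreover have "card ?W - card (?badn \<union> (\<Union>w\<in>x. ?bad w)) \<le> card (?ext x)"
      by (rule diff_card_le_card_Diff) (use finA x(2) in auto)
    then have "real (card ?W) - real (card (?badn \<union> (\<Union>w\<in>x. ?bad w))) \<le> real (card (?ext x))"
      by linarith
    ultimately show ?thesis using size[OF v] by (simp add: algebra_simps)
  qed
  let ?h = "\<lambda>(x, u). insert u x"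
  have inj: "inj_on ?h (Sigma (?G f) ?ext)"
  proof (rule inj_onI)
    fix p q assume pq: "p \<in> Sigma (?G f) ?ext" "q \<in> Sigma (?G f) ?ext" "?h p = ?h q"
    \<comment> \<open>The new vertex is the only one in part \<open>v\<close>, so both the old set
      and the new vertex can be read off from their union.\<close>
    have *: "fst p' = {y \<in> ?h p'. part y \<noteq> v}" "{snd p'} = {y \<in> ?h p'. part y = v}"
      if p': "p' \<in> Sigma (?G f) ?ext" for p'
    proof -
      have "part y \<noteq> v" if "y \<in> fst p'" for y
      proof -
        have "bij_betw part (fst p') f" using p' by auto
        then show ?thesis using that bij_betwE insert.hyps(2) by blast
      qed
      moreover have "part (snd p') = v" using p' by auto
      ultimately show "fst p' = {y \<in> ?h p'. part y \<noteq> v}" "{snd p'} = {y \<in> ?h p'. part y = v}"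
        by (auto simp: case_prod_beta)
    qed
    have "fst p = fst q" using *(1)[OF pq(1)] *(1)[OF pq(2)] pq(3) by simp
    moreover have "{snd p} = {snd q}" using *(2)[OF pq(1)] *(2)[OF pq(2)] pq(3) by simp
    ultimately show "p = q" by (simp add: prod_eq_iff)
  qed
  have "?h ` Sigma (?G f) ?ext \<subseteq> ?G (insert v f)"
  proof
    fix y assume "y \<in> ?h ` Sigma (?G f) ?ext"
    then obtain x u where y: "y = insert u x" and x: "x \<in> ?G f" and u: "u \<in> ?ext x" by auto
    have "near_orthogonal d P vec y"
    proof -
      have old: "near_orthogonal d P vec x" using x by simp
      have new: "\<bar>ip d (vec u) (vec u) - P\<bar> \<le> real d" "\<forall>w\<in>x. \<bar>ip d (vec u) (vec w)\<bar> \<le> real d"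
        using u by (auto simp: not_less)
      then have "\<forall>w\<in>x. \<bar>ip d (vec w) (vec u)\<bar> \<le> real d"
        by (simp add: ip_commute)
      with old new show ?thesis unfolding y near_orthogonal_def by blast
    qed
    moreover have "bij_betw part y (insert v f)"
      using x u insert.hyps unfolding y by (auto simp: bij_betw_def)
    ultimately show "y \<in> ?G (insert v f)" using x u y by auto
  qed
  then have "card (Sigma (?G f) ?ext) \<le> card (?G (insert v f))"
    by (rule card_inj_on_le[OF inj _ finG])
  moreover have "card (Sigma (?G f) ?ext) = (\<Sum>x\<in>?G f. card (?ext x))"
    using finG finA by (intro card_SigmaI) auto
  ultimately have "(\<Sum>x\<in>?G f. real (card (?ext x))) \<le> real (card (?G (insert v f)))"
    by (simp flip: of_nat_sum)
  moreover have "(\<Sum>x\<in>?G f. T * (1 - real r * \<delta>)) \<le> (\<Sum>x\<in>?G f. real (card (?ext x)))"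
    by (intro sum_mono ext)
  moreover have "T * (1 - real r * \<delta>) * (T * (1 - real r * \<delta>)) ^ card f
      \<le> T * (1 - real r * \<delta>) * real (card (?G f))"
    using insert assms(1,3) by (intro mult_left_mono) auto
  ultimately show ?case using insert.hyps by (simp add: mult.commute)
qed

text \<open>Base sets are classified by the edge of \<open>E\<^sub>0\<close> they project to; the
  classes are disjoint, and each is bounded by the preceding count.\<close>

lemma card_base_ge:
  assumes "T \<ge> 0" and "0 \<le> \<delta>" and "real r * \<delta> \<le> 1"
    and size: "\<And>v. v \<in> V\<^sub>0 \<Longrightarrow> T \<le> real (card {u \<in> A. part u = v})"
    and norm: "\<And>v. v \<in> V\<^sub>0 \<Longrightarrow> real (card {u \<in> A. part u = v \<and> \<bar>ip d (vec u) (vec u) - P\<bar> > real d}) \<le> \<delta> * T"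
    and orth: "\<And>v w. v \<in> V\<^sub>0 \<Longrightarrow> w \<in> A \<Longrightarrow> real (card {u \<in> A. part u = v \<and> \<bar>ip d (vec u) (vec w)\<bar> > real d}) \<le> \<delta> * T"
  shows "real (card E\<^sub>0) * (T * (1 - real r * \<delta>)) ^ r \<le> real (card base)"
proof -
  let ?G = "\<lambda>f. {x. x \<subseteq> A \<and> bij_betw part x f \<and> near_orthogonal d P vec x}"
  have finA: "finite A" using finite_V AC_subset finite_subset by (metis le_sup_iff)
  have E0: "finite E\<^sub>0" "\<And>f. f \<in> E\<^sub>0 \<Longrightarrow> f \<subseteq> V\<^sub>0 \<and> finite f \<and> card f = r"
    using hyper0 finite_subset[of E\<^sub>0 "nsets V\<^sub>0 r"]
    by (auto simp: uniform_hypergraph_def finite_imp_finite_nsets nsets_def)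
  have "base = (\<Union>f\<in>E\<^sub>0. ?G f)" by (auto simp: base_def bij_betw_def)
  also have "card \<dots> = (\<Sum>f\<in>E\<^sub>0. card (?G f))"
    using E0(1) finA by (intro card_UN_disjoint) (auto simp: bij_betw_def intro: finite_subset[of _ "Pow A"])
  finally have "real (card base) = (\<Sum>f\<in>E\<^sub>0. real (card (?G f)))" by simp
  moreover have "(\<Sum>f\<in>E\<^sub>0. (T * (1 - real r * \<delta>)) ^ r) \<le> (\<Sum>f\<in>E\<^sub>0. real (card (?G f)))"
  proof (rule sum_mono)
    fix f assume "f \<in> E\<^sub>0"
    then show "(T * (1 - real r * \<delta>)) ^ r \<le> real (card (?G f))"
      using card_near_orthogonal_transversals[OF assms, of f] E0(2)[of f] by simp
  qed
  ultimately show ?thesis by simp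
qed

end

section \<open>Blow-ups of lattice grids\<close>

lemma card_bij_betw_Collect:
  assumes "bij_betw g A S"
  shows "card {u \<in> A. Q (g u)} = card {p \<in> S. Q p}"
proof -
  have "bij_betw g {u \<in> A. Q (g u)} {p \<in> S. Q p}"
    using assms by (auto simp: bij_betw_def inj_on_def)
  then show ?thesis by (rule bij_betw_same_card)
qed

text \<open>The squares of the coordinates, centred by their mean \<open>M\<close>, are bounded by
  \<open>R\<^sup>2\<close>; \<open>P\<close> is \<open>d * M\<close>.\<close>

lemma card_large_norm_deviation:
  assumes "d > 0"
  obtains P where "real (card {x \<in> PiE {..<d} (\<lambda>_. {- int R..int R}). \<bar>ip d x x - P\<bar> > real d})
    \<le> real R ^ 4 / real d * real (2 * R + 1) ^ d"
proof -
  let ?B = "{- int R..int R}"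
  let ?sq = "\<lambda>v::int. (real_of_int v)\<^sup>2"
  define M where "M = (\<Sum>v\<in>?B. ?sq v) / real (card ?B)"
  have card_B: "card ?B = 2 * R + 1" by simp
  have sq: "0 \<le> ?sq v" "?sq v \<le> (real R)\<^sup>2" if "v \<in> ?B" for v
    using that by (auto simp flip: abs_le_square_iff)
  have "(\<Sum>v\<in>?B. ?sq v) \<le> real (card ?B) * (real R)\<^sup>2"
    using sq by (intro sum_bounded_above) auto
  then have M: "0 \<le> M" "M \<le> (real R)\<^sup>2"
    unfolding M_def card_B by (auto simp: sum_nonneg divide_le_eq mult.commute)
  have "(\<Sum>v\<in>?B. ?sq v - M) = 0"
    using card_B by (simp add: sum_subtractf M_def del: card_atLeastAtMost_int)
  moreover have "\<bar>?sq v - M\<bar> \<le> (real R)\<^sup>2" if "v \<in> ?B" for v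
    using sq[OF that] M by linarith
  ultimately have "real (card {x \<in> PiE {..<d} (\<lambda>_. ?B). \<bar>\<Sum>i<d. 1 * (?sq (x i) - M)\<bar> > real d})
      \<le> ((real R)\<^sup>2 * 1)\<^sup>2 / real d * real (card ?B) ^ d"
    by (intro card_large_deviation_PiE[OF assms]) auto
  moreover have "(\<Sum>i<d. 1 * (?sq (x i) - M)) = ip d x x - real d * M" for x
    by (simp add: ip_def sum_subtractf power2_eq_square)
  ultimately show thesis
    by (intro that[of "real d * M"]) (simp only: card_B mult_1_right flip: power_mult, simp)
qed

text \<open>With \<open>a\<close> fixed, the inner product is a weighted sum of coordinates, centred
  by the symmetry of the grid; weights and coordinates are both bounded by \<open>R\<close>.\<close>

lemma card_large_ip:
  assumes "d > 0" and "\<And>i. i < d \<Longrightarrow> \<bar>a i\<bar> \<le> int R"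
  shows "real (card {x \<in> PiE {..<d} (\<lambda>_. {- int R..int R}). \<bar>ip d x a\<bar> > real d})
    \<le> real R ^ 4 / real d * real (2 * R + 1) ^ d"
proof -
  let ?B = "{- int R..int R}"
  have card_B: "card ?B = 2 * R + 1" by simp
  have "(\<Sum>v\<in>?B. real_of_int v) = (\<Sum>v\<in>?B. real_of_int (- v))"
    by (rule sum.reindex_bij_witness[of _ uminus uminus]) auto
  then have "(\<Sum>v\<in>?B. real_of_int v) = 0" by (simp add: sum_negf)
  moreover have "\<bar>real_of_int (a i)\<bar> \<le> real R" if "i < d" for i
    using assms(2)[OF that] by linarith
  ultimately have "real (card {x \<in> PiE {..<d} (\<lambda>_. ?B). \<bar>\<Sum>i<d. real_of_int (a i) * real_of_int (x i)\<bar> > real d})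
      \<le> (real R * real R)\<^sup>2 / real d * real (card ?B) ^ d"
    by (intro card_large_deviation_PiE[OF assms(1)]) auto
  moreover have "(\<Sum>i<d. real_of_int (a i) * real_of_int (x i)) = ip d x a" for x
    by (simp add: ip_def mult.commute)
  moreover have "(real R * real R)\<^sup>2 = real R ^ 4" by (simp add: power2_eq_square eval_nat_numeral)
  ultimately show ?thesis by (simp only: card_B)
qed

lemma lattice_blow_up_exists:
  fixes r d R L n :: nat
  defines "q \<equiv> 2 * R + 1" and "\<delta> \<equiv> real R ^ 4 / real d"
  assumes r: "r \<ge> 2" and hyper0: "uniform_hypergraph r V\<^sub>0 E\<^sub>0"
    and clique_free: "complete_copies r (r + 1) V\<^sub>0 E\<^sub>0 = {}"
    and pos: "card V\<^sub>0 > 0" "d > 0" "L > 0" and \<delta>: "real r * \<delta> \<le> 1"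
    and size: "card V\<^sub>0 * L * q ^ d + (2 * r * R + 1) ^ d \<le> n"
  obtains V E where "uniform_hypergraph r V E" "card V = n"
    "real (card E\<^sub>0) * (real L * real q ^ d * (1 - real r * \<delta>)) ^ r \<le> real (card E)"
    "\<And>e. e \<in> E \<Longrightarrow> \<exists>K\<in>complete_copies r (r + 1) V E. e \<subseteq> K"
    "\<And>e. e \<in> E \<Longrightarrow> real (card {K \<in> complete_copies r (r + 1) V E. e \<subseteq> K})
        \<le> real (card V\<^sub>0 * L) * (3 * 2 ^ (4 * r\<^sup>2)) ^ d"
proof -
  define X where "X = PiE {..<d} (\<lambda>_. {- int R..int R})"
  define B where "B = {- int (r * R)..int (r * R)}"
  define Y where "Y = PiE {..<d} (\<lambda>_. B)"
  let ?S = "V\<^sub>0 \<times> {..<L} \<times> X"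
  have finV0: "finite V\<^sub>0" using hyper0 by (simp add: uniform_hypergraph_def)
  have finX: "finite X" and card_X: "card X = q ^ d"
    unfolding X_def q_def by (auto intro!: finite_PiE simp: card_PiE nat_add_distrib nat_mult_distrib)
  have finY: "finite Y" and card_Y: "card Y = (2 * r * R + 1) ^ d"
    unfolding Y_def B_def
    by (auto intro!: finite_PiE simp: card_PiE nat_add_distrib nat_mult_distrib mult_ac)
  have X_bound: "\<bar>x i\<bar> \<le> int R" if "x \<in> X" "i < d" for x i
  proof -
    have "x i \<in> {- int R..int R}" using PiE_mem[OF that(1)[unfolded X_def], of i] that(2) by simp
    then show ?thesis by (simp add: abs_le_iff)
  qed
  have XY: "X \<subseteq> Y"
  proof -
    have "R \<le> r * R" using r by simp
    then have "int R \<le> int (r * R)" by (simp only: of_nat_le_iff)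
    then have "{- int R..int R} \<subseteq> B" unfolding B_def by (auto simp del: of_nat_mult)
    then show ?thesis unfolding X_def Y_def by (intro PiE_mono) auto
  qed
  \<comment> \<open>\<open>A\<close> enumerates \<open>L\<close> grids for every vertex of
    \<open>V\<^sub>0\<close>, \<open>C\<close> enumerates the box \<open>Y\<close> of possible sums
    of \<open>r\<close> grid vectors, and the remaining numbers below \<open>n\<close> are
    padding.\<close>
  define A where "A = {..<card ?S}"
  define C where "C = {card ?S..<card ?S + card Y}"
  have "\<exists>g. bij_betw g A ?S"
    using finV0 finX by (intro finite_same_card_bij) (auto simp: A_def)
  then obtain g where g: "bij_betw g A ?S" by blast
  have "\<exists>g. bij_betw g C Y"
    using finY by (intro finite_same_card_bij) (auto simp: C_def)
  then obtain g' where g': "bij_betw g' C Y" by blast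
  have AC: "A \<inter> C = {}" "A \<union> C \<subseteq> {..<n}"
    using size finV0 finX by (auto simp: A_def C_def card_cartesian_product card_X card_Y mult.assoc)
  define part where "part u = fst (g u)" for u
  define vec where "vec u = (if u \<in> A then snd (snd (g u)) else g' u)" for u
  have gA: "g u \<in> ?S" if "u \<in> A" for u using g that by (auto simp: bij_betw_def)
  have vecA: "vec u \<in> X" if "u \<in> A" for u
    using gA[OF that] that by (auto simp: vec_def)
  have vecC: "vec u = g' u" if "u \<in> C" for u
    using that AC(1) by (auto simp: vec_def)
  have part_card: "card {u \<in> A. part u = v \<and> Q (vec u)} = L * card {x \<in> X. Q x}" if "v \<in> V\<^sub>0" for v Q
  proof -
    have "{u \<in> A. part u = v \<and> Q (vec u)} = {u \<in> A. fst (g u) = v \<and> Q (snd (snd (g u)))}"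
      by (auto simp: part_def vec_def)
    then have "card {u \<in> A. part u = v \<and> Q (vec u)} = card {p \<in> ?S. fst p = v \<and> Q (snd (snd p))}"
      using card_bij_betw_Collect[OF g, of "\<lambda>p. fst p = v \<and> Q (snd (snd p))"] by simp
    also have "{p \<in> ?S. fst p = v \<and> Q (snd (snd p))} = {v} \<times> {..<L} \<times> {x \<in> X. Q x}"
      using that by auto
    finally show ?thesis by (simp add: card_cartesian_product)
  qed
  obtain P where P: "real (card {x \<in> X. \<bar>ip d x x - P\<bar> > real d}) \<le> \<delta> * real q ^ d"
    using card_large_norm_deviation[OF pos(2), of R] unfolding X_def \<delta>_def q_def by blast
  interpret vector_blow_up r d V\<^sub>0 E\<^sub>0 "{..<n}" A C part vec P
    using r hyper0 clique_free AC by unfold_locales auto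
  have apex: "\<exists>s. apex x s" if x: "x \<in> base" for x
  proof -
    \<comment> \<open>The restriction makes the sum extensional, so that it is a point of
      \<open>Y\<close> and has a vertex in \<open>C\<close>.\<close>
    let ?t = "restrict (\<lambda>i. \<Sum>u\<in>x. vec u i) {..<d}"
    have "(\<Sum>u\<in>x. vec u i) \<in> B" if "i < d" for i
    proof -
      have "\<bar>\<Sum>u\<in>x. vec u i\<bar> \<le> (\<Sum>u\<in>x. int R)"
      proof (intro order_trans[OF sum_abs] sum_mono)
        fix u assume "u \<in> x"
        then have "vec u \<in> X" using vecA baseD(1)[OF x] by blast
        then show "\<bar>vec u i\<bar> \<le> int R" using X_bound \<open>i < d\<close> by blast
      qed
      then show ?thesis using baseD(6)[OF x] by (auto simp: B_def)
    qed
    then have "?t \<in> Y" by (auto simp: Y_def)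
    then obtain s where "s \<in> C" "g' s = ?t" using g' by (auto simp: bij_betw_def)
    then show ?thesis using vecC by (auto simp: apex_def intro!: exI[of _ s])
  qed
  have "edges \<subseteq> nsets {..<n} r" by (rule edges_subset)
  moreover have fin_edges: "finite edges"
    using edges_subset finite_imp_finite_nsets[of "{..<n}" r] finite_subset by blast
  ultimately have "uniform_hypergraph r {..<n} edges" by (simp add: uniform_hypergraph_def)
  moreover have "real (card E\<^sub>0) * (real L * real q ^ d * (1 - real r * \<delta>)) ^ r \<le> real (card edges)"
  proof -
    have "real (card E\<^sub>0) * (real L * real q ^ d * (1 - real r * \<delta>)) ^ r \<le> real (card base)"
    proof (rule card_base_ge)
      show "0 \<le> real L * real q ^ d" "0 \<le> \<delta>" "real r * \<delta> \<le> 1" using \<delta> by (auto simp: \<delta>_def)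
      fix v assume v: "v \<in> V\<^sub>0"
      show "real L * real q ^ d \<le> real (card {u \<in> A. part u = v})"
        using part_card[OF v, of "\<lambda>_. True"] by (simp add: card_X)
      show "real (card {u \<in> A. part u = v \<and> \<bar>ip d (vec u) (vec u) - P\<bar> > real d}) \<le> \<delta> * (real L * real q ^ d)"
        using part_card[OF v, of "\<lambda>x. \<bar>ip d x x - P\<bar> > real d"] mult_left_mono[OF P, of "real L"]
        by (simp add: mult.left_commute)
      fix w assume "w \<in> A"
      then have "vec w \<in> X" by (rule vecA)
      then have "\<bar>vec w i\<bar> \<le> int R" if "i < d" for i using X_bound that by blast
      then have "real (card {x \<in> X. \<bar>ip d x (vec w)\<bar> > real d}) \<le> \<delta> * real q ^ d"
        using card_large_ip[OF pos(2), of "vec w" R] unfolding X_def \<delta>_def q_def by blast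
      then show "real (card {u \<in> A. part u = v \<and> \<bar>ip d (vec u) (vec w)\<bar> > real d}) \<le> \<delta> * (real L * real q ^ d)"
        using part_card[OF v, of "\<lambda>x. \<bar>ip d x (vec w)\<bar> > real d"] mult_left_mono[of _ "\<delta> * real q ^ d" "real L"]
        by (simp add: mult.left_commute)
    qed
    moreover have "card base \<le> card edges"
      using base_subset_edges[OF apex] fin_edges by (intro card_mono)
    ultimately show ?thesis by linarith
  qed
  moreover have "real (card {K \<in> complete_copies r (r + 1) {..<n} edges. e \<subseteq> K})
      \<le> real (card V\<^sub>0 * L) * (3 * 2 ^ (4 * r\<^sup>2)) ^ d" if "e \<in> edges" for e
  proof (rule card_copies_le[OF that, of B])
    show "finite B" by (simp add: B_def)
    show "vec u \<in> PiE {..<d} (\<lambda>_. B)" if "u \<in> A \<union> C" for u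
      using that vecA XY vecC g' unfolding Y_def[symmetric] by (auto simp: bij_betw_def)
    fix z
    have "{u \<in> A. vec u = z} = {u \<in> A. snd (snd (g u)) = z}" by (auto simp: vec_def)
    then have "card {u \<in> A. vec u = z} = card {p \<in> ?S. snd (snd p) = z}"
      using card_bij_betw_Collect[OF g, of "\<lambda>p. snd (snd p) = z"] by simp
    also have "\<dots> \<le> card (V\<^sub>0 \<times> {..<L} \<times> {z})"
      using finV0 by (intro card_mono) auto
    finally show "card {u \<in> A. vec u = z} \<le> card V\<^sub>0 * L" by (simp add: card_cartesian_product)
    have "{u \<in> C. vec u = z} = {u \<in> C. g' u = z}" using vecC by auto
    then have "card {u \<in> C. vec u = z} = card {y \<in> Y. y = z}"
      using card_bij_betw_Collect[OF g', of "\<lambda>y. y = z"] by simp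
    also have "\<dots> \<le> card {z}" by (intro card_mono) auto
    also have "\<dots> \<le> card V\<^sub>0 * L" using pos by simp
    finally show "card {u \<in> C. vec u = z} \<le> card V\<^sub>0 * L" .
  qed
  ultimately show thesis using edge_in_copy by (intro that[of "{..<n}" edges]) auto
qed

text \<open>The factor 2 in \<open>Q\<close> makes \<open>(r * (2 * R + 1)) ^ d\<close> at most
  \<open>n / 2 ^ d\<close>, so that the reserve \<open>C\<close> and the rounding of
  \<open>L\<close> together cost a proportion of at most \<open>(m + 1) / 2 ^ d\<close> of the
  vertices. The upper bound on \<open>n\<close> limits \<open>m * L\<close>, the number of vertices
  sharing a vector.\<close>

lemma blow_up_of_given_order:
  fixes r d R n :: nat and V\<^sub>0 :: "nat set" and E\<^sub>0 :: "nat set set"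
  defines "Q \<equiv> 2 * r * (2 * R + 1)" and "\<delta> \<equiv> real R ^ 4 / real d" and "m \<equiv> card V\<^sub>0"
  assumes r: "r \<ge> 2" and hyper0: "uniform_hypergraph r V\<^sub>0 E\<^sub>0"
    and clique_free: "complete_copies r (r + 1) V\<^sub>0 E\<^sub>0 = {}"
    and pos: "m > 0" "d > 0" and \<delta>: "real r * \<delta> \<le> 1"
    and Q: "Q ^ d \<le> n" "n \<le> Q ^ (d + 1)" and d: "m + 1 \<le> 2 ^ d"
  obtains V E where "uniform_hypergraph r V E" "card V = n"
    "real (card E\<^sub>0) * ((1 - real (m + 1) / 2 ^ d) * (1 - real r * \<delta>) * real n / real m) ^ r \<le> real (card E)"
    "\<And>e. e \<in> E \<Longrightarrow> \<exists>K\<in>complete_copies r (r + 1) V E. e \<subseteq> K"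
    "\<And>e. e \<in> E \<Longrightarrow> real (card {K \<in> complete_copies r (r + 1) V E. e \<subseteq> K})
        \<le> real Q * real (2 * r * (3 * 2 ^ (4 * r\<^sup>2))) ^ d"
proof -
  define q where "q = 2 * R + 1"
  define Y where "Y = (2 * r * R + 1) ^ d"
  \<comment> \<open>The largest number of grids per part that fits beside the reserve.\<close>
  define L where "L = (n - Y) div (m * q ^ d)"
  have q: "q > 0" by (simp add: q_def)
  have Qq: "Q = 2 * (r * q)" by (simp add: Q_def q_def)
  have rq: "2 ^ d * (r * q) ^ d \<le> n" using Q(1) unfolding Qq power_mult_distrib[of 2 "r * q"] .
  have Y: "Y \<le> (r * q) ^ d" unfolding Y_def q_def using r by (intro power_mono) auto
  have qd: "q ^ d \<le> (r * q) ^ d" using r by (intro power_mono) auto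
  have small: "2 ^ d * (Y + m * q ^ d) \<le> (m + 1) * n"
  proof -
    have "2 ^ d * (Y + m * q ^ d) \<le> 2 ^ d * ((r * q) ^ d + m * (r * q) ^ d)"
      using Y qd by (intro mult_left_mono add_mono) auto
    also have "\<dots> = (m + 1) * (2 ^ d * (r * q) ^ d)" by (simp add: algebra_simps)
    also have "\<dots> \<le> (m + 1) * n" using rq by (intro mult_left_mono) auto
    finally show ?thesis .
  qed
  also have "\<dots> \<le> 2 ^ d * n" using d by (intro mult_right_mono) auto
  finally have fits: "Y + m * q ^ d \<le> n" by simp
  then have "L > 0" using pos q by (simp add: L_def div_greater_zero_iff)
  have L_le: "L * (m * q ^ d) \<le> n - Y" unfolding L_def by (rule div_times_less_eq_dividend)
  have "n - Y < (L + 1) * (m * q ^ d)"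
    unfolding L_def using pos q dividend_less_div_times[of "m * q ^ d" "n - Y"] by simp
  then have L_ge: "n \<le> L * (m * q ^ d) + (Y + m * q ^ d)" by (simp add: algebra_simps)
  have size: "card V\<^sub>0 * L * (2 * R + 1) ^ d + (2 * r * R + 1) ^ d \<le> n"
  proof -
    have "L * (m * q ^ d) + Y \<le> n" using L_le fits by linarith
    then show ?thesis unfolding m_def q_def Y_def by (simp only: mult_ac)
  qed
  obtain V E where VE: "uniform_hypergraph r V E" "card V = n"
    "real (card E\<^sub>0) * (real L * real (2 * R + 1) ^ d * (1 - real r * \<delta>)) ^ r \<le> real (card E)"
    "\<And>e. e \<in> E \<Longrightarrow> \<exists>K\<in>complete_copies r (r + 1) V E. e \<subseteq> K"
    "\<And>e. e \<in> E \<Longrightarrow> real (card {K \<in> complete_copies r (r + 1) V E. e \<subseteq> K})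
        \<le> real (card V\<^sub>0 * L) * (3 * 2 ^ (4 * r\<^sup>2)) ^ d"
    using lattice_blow_up_exists[OF r hyper0 clique_free _ pos(2) \<open>L > 0\<close> _ size] pos(1) \<delta>
    unfolding m_def \<delta>_def by blast
  have "(1 - real (m + 1) / 2 ^ d) * real n \<le> real L * real q ^ d * real m"
  proof -
    have "real n \<le> real L * (real m * real q ^ d) + (real Y + real m * real q ^ d)"
      using of_nat_mono[OF L_ge, where 'a = real] by simp
    moreover have "2 ^ d * (real Y + real m * real q ^ d) \<le> real (m + 1) * real n"
      using of_nat_mono[OF small, where 'a = real] by (simp add: algebra_simps)
    then have "real Y + real m * real q ^ d \<le> real (m + 1) / 2 ^ d * real n"
      by (simp add: pos_le_divide_eq mult.commute)
    ultimately show ?thesis by (simp add: algebra_simps)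
  qed
  then have "(1 - real (m + 1) / 2 ^ d) * real n / real m \<le> real L * real q ^ d"
    using pos by (simp add: divide_le_eq)
  then have "(1 - real (m + 1) / 2 ^ d) * real n / real m * (1 - real r * \<delta>)
      \<le> real L * real q ^ d * (1 - real r * \<delta>)"
    using \<delta> by (intro mult_right_mono) auto
  moreover have "0 \<le> (1 - real (m + 1) / 2 ^ d)"
    using of_nat_mono[OF d, where 'a = real] by (simp add: divide_le_eq)
  ultimately have "((1 - real (m + 1) / 2 ^ d) * (1 - real r * \<delta>) * real n / real m) ^ r
      \<le> (real L * real q ^ d * (1 - real r * \<delta>)) ^ r"
    using \<delta> by (intro power_mono) (auto simp: mult_ac)
  then have "real (card E\<^sub>0) * ((1 - real (m + 1) / 2 ^ d) * (1 - real r * \<delta>) * real n / real m) ^ r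
      \<le> real (card E\<^sub>0) * (real L * real q ^ d * (1 - real r * \<delta>)) ^ r"
    by (intro mult_left_mono) auto
  with VE(3) have card_E: "real (card E\<^sub>0) * ((1 - real (m + 1) / 2 ^ d) * (1 - real r * \<delta>) * real n / real m) ^ r \<le> real (card E)"
    unfolding q_def by (rule order_trans[rotated])
  have "m * L \<le> Q * (2 * r) ^ d"
  proof -
    have "m * L * q ^ d \<le> n" using L_le by (simp add: mult_ac)
    also have "\<dots> \<le> Q * (2 * r) ^ d * q ^ d" using Q(2)
      by (simp add: Qq power_mult_distrib mult_ac)
    finally show ?thesis using q by simp
  qed
  then have "real (m * L) \<le> real (Q * (2 * r) ^ d)" by (simp only: of_nat_le_iff)
  then have "real (m * L) * (3 * 2 ^ (4 * r\<^sup>2)) ^ d \<le> real (Q * (2 * r) ^ d) * (3 * 2 ^ (4 * r\<^sup>2)) ^ d"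
    by (intro mult_right_mono) auto
  also have "\<dots> = real Q * real (2 * r * (3 * 2 ^ (4 * r\<^sup>2))) ^ d"
    by (simp only: of_nat_mult of_nat_power of_nat_numeral power_mult_distrib mult.assoc)
  finally show thesis
    using VE(1,2,4,5) card_E unfolding m_def[symmetric] by (intro that) (auto intro: order_trans)
qed

section \<open>Choice of the parameters\<close>

text \<open>A single admissible hypergraph bounds every \<open>h\<close> in the supremum; as
  \<open>h\<close> is an integer, \<open>B\<close> may be rounded down.\<close>

lemma max_edge_copies_le:
  assumes "admissible_hypergraph r n c V E" and "B \<ge> 0"
    and bound: "\<And>e. e \<in> E \<Longrightarrow> real (card {K \<in> complete_copies r (r + 1) V E. e \<subseteq> K}) \<le> B"
  shows "ereal_of_enat (max_edge_copies r n c) \<le> ereal B"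
proof -
  have "max_edge_copies r n c \<le> enat (nat \<lfloor>B\<rfloor>)"
    unfolding max_edge_copies_def
  proof (rule Sup_least, clarify)
    fix h assume "\<forall>V E. admissible_hypergraph r n c V E \<longrightarrow>
      (\<exists>e\<in>E. h \<le> card {K \<in> complete_copies r (r + 1) V E. e \<subseteq> K})"
    then obtain e where "e \<in> E" "h \<le> card {K \<in> complete_copies r (r + 1) V E. e \<subseteq> K}"
      using assms(1) by blast
    then have "real h \<le> B" using bound[of e] by linarith
    then show "enat h \<le> enat (nat \<lfloor>B\<rfloor>)" using le_nat_floor by simp
  qed
  then have "ereal_of_enat (max_edge_copies r n c) \<le> ereal_of_enat (enat (nat \<lfloor>B\<rfloor>))"
    by (simp only: ereal_of_enat_le_iff)
  also have "\<dots> \<le> ereal B" using assms(2) of_nat_floor[of B] by simp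
  finally show ?thesis .
qed

text \<open>The dimension is of order \<open>ln n / ln ln n\<close>; with this choice of the side length the quotient
  \<open>side ^ 4 / dimension\<close> in the concentration estimates tends to \<open>0\<close>.\<close>

definition side :: "nat \<Rightarrow> nat" where
  "side n = nat \<lfloor>ln (real n) powr (1 / 5)\<rfloor>"

text \<open>The \<open>Q\<close> of \<open>blow_up_of_given_order\<close> with
  \<open>R = side n\<close>. The word refers to the base of a logarithm, whose integer part at
  \<open>n\<close> is the dimension, and not to base sets.\<close>

definition base_of :: "nat \<Rightarrow> nat \<Rightarrow> nat" where
  "base_of r n = 2 * r * (2 * side n + 1)"

definition dimension :: "nat \<Rightarrow> nat \<Rightarrow> nat" where
  "dimension r n = nat \<lfloor>ln (real n) / ln (real (base_of r n))\<rfloor>"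

lemma side_bounds:
  assumes "n \<ge> 1"
  shows "real (side n) \<le> ln (real n) powr (1 / 5)" "ln (real n) powr (1 / 5) < real (side n) + 1"
  unfolding side_def using assms by (auto intro: of_nat_floor)

text \<open>The upper bound makes the dimension large, the lower bound makes it
  \<open>O(ln n / ln ln n)\<close>, and the value 4 keeps the logarithm in the denominator
  positive.\<close>

lemma base_of_bounds:
  assumes "n \<ge> 1" and "r \<ge> 2"
  shows "real (base_of r n) \<le> 2 * real r * (2 * ln (real n) powr (1 / 5) + 1)"
    "ln (real n) powr (1 / 5) \<le> real (base_of r n)" "base_of r n \<ge> 4"
proof -
  have "real (base_of r n) = 2 * real r * (2 * real (side n) + 1)" by (simp add: base_of_def algebra_simps)
  also have "\<dots> \<le> 2 * real r * (2 * ln (real n) powr (1 / 5) + 1)"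
    using side_bounds(1)[OF assms(1)] by (intro mult_left_mono add_right_mono) auto
  finally show "real (base_of r n) \<le> 2 * real r * (2 * ln (real n) powr (1 / 5) + 1)" .
  have Q: "4 * (2 * side n + 1) \<le> base_of r n"
    unfolding base_of_def using assms(2) by (intro mult_right_mono) auto
  from order_trans[OF _ this] show "base_of r n \<ge> 4" by simp
  have "8 * real (side n) + 4 \<le> real (base_of r n)"
    using of_nat_mono[OF Q, where 'a = real] by simp
  then show "ln (real n) powr (1 / 5) \<le> real (base_of r n)"
    using side_bounds(2)[OF assms(1)] of_nat_0_le_iff[of "side n", where 'a = real] by linarith
qed

lemma base_of_power_dimension:
  assumes "n \<ge> 1" and "r \<ge> 2"
  shows "base_of r n ^ dimension r n \<le> n" "n \<le> base_of r n ^ (dimension r n + 1)"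
proof -
  let ?Q = "base_of r n" and ?d = "dimension r n"
  have Q: "ln (real ?Q) > 0" "real ?Q > 0" using base_of_bounds(3)[OF assms] by auto
  have n: "ln (real n) \<ge> 0" "real n > 0" using assms by auto
  have d: "real ?d \<le> ln (real n) / ln (real ?Q)" "ln (real n) / ln (real ?Q) \<le> real (?d + 1)"
    unfolding dimension_def using Q n by (auto intro: of_nat_floor) linarith
  have "ln (real ?Q ^ ?d) \<le> ln (real n)"
    using d(1) Q by (simp add: ln_realpow pos_le_divide_eq)
  then have "real ?Q ^ ?d \<le> real n" using Q n by (subst (asm) ln_le_cancel_iff) auto
  then show "?Q ^ ?d \<le> n" by (simp flip: of_nat_power)
  have "ln (real n) \<le> ln (real ?Q ^ (?d + 1))"
    using d(2) Q by (subst ln_realpow) (auto simp: pos_divide_le_eq)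
  then have "real n \<le> real ?Q ^ (?d + 1)"
    using Q n by (subst (asm) ln_le_cancel_iff) auto
  then show "n \<le> ?Q ^ (?d + 1)" by (simp only: of_nat_le_iff flip: of_nat_power)
qed

lemma dimension_ge:
  assumes "n \<ge> 1" and "r \<ge> 2"
  shows "ln (real n) / ln (2 * real r * (2 * ln (real n) powr (1 / 5) + 1)) - 1 \<le> real (dimension r n)"
proof -
  have Q: "real (base_of r n) \<ge> 4" using base_of_bounds(3)[OF assms] by simp
  then have "ln (real n) / ln (2 * real r * (2 * ln (real n) powr (1 / 5) + 1))
      \<le> ln (real n) / ln (real (base_of r n))"
    using base_of_bounds(1)[OF assms] assms by (intro divide_left_mono) auto
  also have "\<dots> \<le> real (dimension r n) + 1" unfolding dimension_def by linarith
  finally show ?thesis by simp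
qed

lemma dimension_at_top:
  assumes "r \<ge> 2"
  shows "filterlim (dimension r) at_top sequentially"
proof -
  have r: "real r > 0" using assms by simp
  have "filterlim (\<lambda>n. ln (real n) / ln (2 * real r * (2 * ln (real n) powr (1 / 5) + 1)) - 1) at_top sequentially"
    using r by real_asymp
  then have "filterlim (\<lambda>n. real (dimension r n)) at_top sequentially"
    by (rule filterlim_at_top_mono)
      (rule eventually_mono[OF eventually_ge_at_top[of 1] dimension_ge[OF _ assms]])
  then show ?thesis by (simp add: filterlim_sequentially_iff_filterlim_real)
qed

text \<open>The numerator is at most \<open>(ln n) powr (4/5)\<close>, while the dimension is of
  order \<open>ln n / ln ln n\<close>. An exponent below 1/4 in \<open>side\<close> is what makes
  this work.\<close>

lemma side_dimension_quotient_tendsto_0: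
  assumes "r \<ge> 2"
  shows "(\<lambda>n. real (side n) ^ 4 / real (dimension r n)) \<longlonglongrightarrow> 0"
proof -
  have r: "real r > 0" using assms by simp
  let ?D = "\<lambda>n. ln (real n) / ln (2 * real r * (2 * ln (real n) powr (1 / 5) + 1)) - 1"
  have lim: "(\<lambda>n. (ln (real n) powr (1 / 5)) ^ 4 / ?D n) \<longlonglongrightarrow> 0"
    using r by real_asymp
  have "eventually (\<lambda>n. ?D n > 0) sequentially" using r by real_asymp
  then have le: "eventually (\<lambda>n. real (side n) ^ 4 / real (dimension r n)
      \<le> (ln (real n) powr (1 / 5)) ^ 4 / ?D n) sequentially"
    using eventually_ge_at_top[of 1]
  proof eventually_elim
    case (elim n)
    then show ?case
      using side_bounds(1)[of n] dimension_ge[OF _ assms, of n]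
      by (intro frac_le power_mono) auto
  qed
  show ?thesis by (rule tendsto_sandwich[OF _ le tendsto_const lim]) simp
qed

text \<open>After taking logarithms, \<open>base_of r n\<close> is polylogarithmic and contributes
  at most \<open>ln n / ln ln n\<close>, the summand 1. Its logarithm is at least
  \<open>ln (ln n) / 5\<close>, so the dimension is at most \<open>5 * ln n / ln ln n\<close>,
  whence \<open>5 * ln G\<close>.\<close>

lemma copies_bound_asymptotic:
  fixes G :: real
  assumes "r \<ge> 2" and "G \<ge> 1"
  shows "\<forall>\<^sub>F n in sequentially. real (base_of r n) * G ^ dimension r n
    \<le> real n powr ((1 + 5 * ln G) / ln (ln (real n)))"
proof -
  have r: "real r > 0" using assms by simp
  have "eventually (\<lambda>n. ln (2 * real r * (2 * ln (real n) powr (1 / 5) + 1)) \<le> ln (real n) / ln (ln (real n))) sequentially"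
    using r by real_asymp
  moreover have "eventually (\<lambda>n. ln (ln (real n)) > 0 \<and> ln (real n) > 0) sequentially"
    by (intro eventually_conj) real_asymp+
  ultimately show ?thesis using eventually_ge_at_top[of 1]
  proof eventually_elim
    case (elim n)
    let ?l = "ln (real n)" and ?Q = "real (base_of r n)" and ?d = "real (dimension r n)"
    have Q: "?Q \<ge> 4" using base_of_bounds(3)[OF elim(3) assms(1)] by simp
    have "ln ?Q \<le> ln (2 * real r * (2 * ?l powr (1 / 5) + 1))"
      using Q base_of_bounds(1)[OF elim(3) assms(1)] by (intro ln_mono) auto
    then have lnQ: "ln ?Q \<le> ?l / ln ?l" using elim(1) by linarith
    have "ln ?l / 5 = ln (?l powr (1 / 5))" using elim by (simp add: ln_powr)
    also have "\<dots> \<le> ln ?Q"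
      using Q elim base_of_bounds(2)[OF elim(3) assms(1)] by (intro ln_mono) auto
    finally have "?l / ln ?Q \<le> ?l / (ln ?l / 5)" using elim Q by (intro divide_left_mono) auto
    moreover have "?d \<le> ?l / ln ?Q"
      unfolding dimension_def using elim Q by (intro of_nat_floor) auto
    ultimately have "?d \<le> 5 * (?l / ln ?l)" by (simp add: mult.commute)
    then have "?d * ln G \<le> 5 * (?l / ln ?l) * ln G"
      using assms(2) by (intro mult_right_mono) auto
    with lnQ have "ln ?Q + ?d * ln G \<le> (1 + 5 * ln G) / ln ?l * ?l"
      by (simp add: algebra_simps add_divide_distrib)
    then have "exp (ln ?Q + ?d * ln G) \<le> exp ((1 + 5 * ln G) / ln ?l * ?l)" by simp
    also have "exp (ln ?Q + ?d * ln G) = ?Q * G ^ dimension r n"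
      using Q assms(2) by (simp add: exp_add exp_of_nat_mult)
    also have "exp ((1 + 5 * ln G) / ln ?l * ?l) = real n powr ((1 + 5 * ln G) / ln ?l)"
      using elim(3) by (simp add: powr_def)
    finally show ?case .
  qed
qed

theorem theorem1p1:
  fixes k :: nat and c :: real
  assumes "k \<ge> 3" and "0 < c" and "c < turan_density k"
  shows "\<exists>b::real. b > 0 \<and>
    (\<forall>\<^sub>F n in sequentially.
       ereal_of_enat (max_edge_copies (k - 1) n c) \<le> ereal (real n powr (b / ln (ln (real n)))))"
proof -
  define r where "r = k - 1"
  have r: "r \<ge> 2" and k: "k = r + 1" using assms(1) by (auto simp: r_def)
  obtain V\<^sub>0 E\<^sub>0 where hyper0: "uniform_hypergraph r V\<^sub>0 E\<^sub>0" and V0: "card V\<^sub>0 > 0"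
    and free: "complete_copies r (r + 1) V\<^sub>0 E\<^sub>0 = {}"
    and dense: "real (card E\<^sub>0) > c * real (card V\<^sub>0) ^ r"
    using dense_clique_free_hypergraph[OF assms(3)] k by auto
  define m where "m = card V\<^sub>0"
  define G where "G = real (2 * r * (3 * 2 ^ (4 * r\<^sup>2)))"
  have "1 \<le> 2 * r * (3 * 2 ^ (4 * r\<^sup>2))" using r by simp
  from of_nat_mono[OF this, where 'a = real] have G: "G \<ge> 1" unfolding G_def by (simp only: of_nat_1)
  define \<delta> where "\<delta> n = real (side n) ^ 4 / real (dimension r n)" for n
  \<comment> \<open>The proportion of the ideal blow-up that survives: the first factor accounts for
    reserve and rounding, the second for near-orthogonality. It tends to 1.\<close>
  define \<theta> where "\<theta> n = (1 - real (m + 1) / 2 ^ dimension r n) * (1 - real r * \<delta> n)" for n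
  have \<delta>: "\<delta> \<longlonglongrightarrow> 0"
    unfolding \<delta>_def using side_dimension_quotient_tendsto_0[OF r] .
  have "(\<lambda>d. real (m + 1) / 2 ^ d) \<longlonglongrightarrow> 0"
    by real_asymp
  then have pow: "(\<lambda>n. real (m + 1) / 2 ^ dimension r n) \<longlonglongrightarrow> 0"
    by (rule filterlim_compose[OF _ dimension_at_top[OF r]])
  have "\<theta> \<longlonglongrightarrow> (1 - 0) * (1 - real r * 0)"
    unfolding \<theta>_def by (intro tendsto_intros pow \<delta>)
  then have "(\<lambda>n. real (card E\<^sub>0) * (\<theta> n / real m) ^ r) \<longlonglongrightarrow> real (card E\<^sub>0) * (1 / real m) ^ r"
    using V0 by (intro tendsto_intros) (auto simp: m_def)
  moreover have "c < real (card E\<^sub>0) * (1 / real m) ^ r"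
    using dense V0 by (simp add: m_def power_divide pos_less_divide_eq)
  ultimately have ev1: "eventually (\<lambda>n. c < real (card E\<^sub>0) * (\<theta> n / real m) ^ r) sequentially"
    by (rule order_tendstoD)
  have ev2: "eventually (\<lambda>n. real (m + 1) / 2 ^ dimension r n < 1) sequentially"
    using pow by (rule order_tendstoD) simp
  have "(\<lambda>n. real r * \<delta> n) \<longlonglongrightarrow> 0" using tendsto_mult_left[OF \<delta>, of "real r"] by simp
  then have ev3: "eventually (\<lambda>n. real r * \<delta> n < 1) sequentially"
    by (rule order_tendstoD) simp
  have ev4: "eventually (\<lambda>n. dimension r n > 0) sequentially"
    by (rule eventually_compose_filterlim[OF eventually_gt_at_top dimension_at_top[OF r]])
  have "\<forall>\<^sub>F n in sequentially. ereal_of_enat (max_edge_copies r n c)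
      \<le> ereal (real n powr ((1 + 5 * ln G) / ln (ln (real n))))"
    using copies_bound_asymptotic[OF r G] ev1 ev2 ev3 ev4 eventually_ge_at_top[of 1]
  proof eventually_elim
    case (elim n)
    have "real (m + 1) \<le> real (2 ^ dimension r n)" using elim(3) by (simp add: divide_less_eq)
    then have "card V\<^sub>0 + 1 \<le> 2 ^ dimension r n" unfolding m_def by (simp only: of_nat_le_iff)
    note blow_up_of_given_order[OF r hyper0 free V0 elim(5) less_imp_le[OF elim(4)[unfolded \<delta>_def]]
        base_of_power_dimension[OF elim(6) r, unfolded base_of_def] this]
    from this[folded base_of_def m_def \<delta>_def G_def, folded \<theta>_def]
    obtain V E where VE: "uniform_hypergraph r V E" "card V = n"
      "real (card E\<^sub>0) * (\<theta> n * real n / real m) ^ r \<le> real (card E)"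
      "\<And>e. e \<in> E \<Longrightarrow> \<exists>K\<in>complete_copies r (r + 1) V E. e \<subseteq> K"
      "\<And>e. e \<in> E \<Longrightarrow> real (card {K \<in> complete_copies r (r + 1) V E. e \<subseteq> K})
          \<le> real (base_of r n) * G ^ dimension r n"
      by blast
    have "c * real n ^ r \<le> real (card E\<^sub>0) * (\<theta> n / real m) ^ r * real n ^ r"
      using elim(2) by (intro mult_right_mono) auto
    also have "\<dots> = real (card E\<^sub>0) * (\<theta> n * real n / real m) ^ r"
      by (simp add: power_divide power_mult_distrib)
    finally have "admissible_hypergraph r n c V E"
      using VE by (auto simp: admissible_hypergraph_def)
    then show ?case
      using VE(5) elim(1) by (intro max_edge_copies_le) (auto intro: order_trans)
  qed
  \<comment> \<open>This is the constant \<open>b\<close>; through \<open>G\<close> it depends on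
    \<open>k\<close> only.\<close>
  moreover have "1 + 5 * ln G > 0" using G by (simp add: add_pos_nonneg)
  ultimately show ?thesis unfolding r_def by blast
qed

end
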